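(* A looped simple graph is a rigid $\mathcal{M}_{lc}$-circuit if and only if it can be obtained from $K_1^{[3]}$ by recursively applying the $1$-extension and $K_4$-extension operations.
   Context: A looped simple graph $G=(V,E,L)$: $E$ is a set of non-loop edges with no parallel edges, $L$ a set of loops (several may be at one vertex). For $X\subseteq V$, $i_E(X)$ and $i_L(X)$ are the numbers of edges, resp. loops, of the subgraph induced by $X$, and $i_{E\cup L}(X)=i_E(X)+i_L(X)$. $G$ is a rigid $\mathcal{M}_{lc}$-circuit if $|E|+|L|=2|V|+1$, $i_E(X)\le 2|X|-3$ for all $X\subseteq V$ with $|X|\ge 2$, and $i_{E\cup L}(X)\le 2|X|$ for all $X\subsetneq V$. $K_1^{[3]}$ is one vertex with three loops. The $1$-extension at an edge $uw$ deletes $uw$ and adds a new vertex $v$, edges $uv,wv$ and either an edge $vx$ ($x\in V\setminus\{u,w\}$) or a loop at $v$; the $1$-extension at a loop at $u$ deletes it and adds a new vertex $v$, an edge $uv$, a loop at $v$ and either an edge $wv$ ($w\in V-u$) or a second loop at $v$. $G$ is the $2$-sum of $G_1=(V_1,E_1,L_1)$ and $G_2=(V_2,E_2,L_2)$ along an edge $uv$ if $V_1\cup V_2=V$, $V_1\cap V_2=\{u,v\}$, $E_1\cap E_2=\{uv\}$, $E=(E_1\cup E_2)-uv$, $L=L_1\cup L_2$, $L_1\cap L_2=\emptyset$. A $K_4$-extension replaces a graph $G_1$ containing an edge $uv$ by the $2$-sum of $G_1$ and a copy of $K_4$ along $uv$. *)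

theory Defs
  imports Main
begin

text \<open>
  A loop is its end-vertex together with a label; the label only serves to tell apart several
  loops at the same vertex. A non-loop edge is its two-element set of end-vertices.
\<close>

type_synonym 'a loop = "'a \<times> nat"

record 'a lgraph =
  verts :: "'a set"
  edges :: "'a set set"
  loops :: "'a loop set"

definition looped_simple_graph :: "'a lgraph \<Rightarrow> bool" where
  "looped_simple_graph G \<longleftrightarrow>
     finite (verts G) \<and>
     (\<forall>e\<in>edges G. e \<subseteq> verts G \<and> card e = 2) \<and>
     finite (loops G) \<and>
     (\<forall>l\<in>loops G. fst l \<in> verts G)"

definition i_edges :: "'a lgraph \<Rightarrow> 'a set \<Rightarrow> nat" where
  "i_edges G X = card {e \<in> edges G. e \<subseteq> X}"

definition i_loops :: "'a lgraph \<Rightarrow> 'a set \<Rightarrow> nat" where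
  "i_loops G X = card {l \<in> loops G. fst l \<in> X}"

definition i_all :: "'a lgraph \<Rightarrow> 'a set \<Rightarrow> nat" where
  "i_all G X = i_edges G X + i_loops G X"

definition rigid_Mlc_circuit :: "'a lgraph \<Rightarrow> bool" where
  "rigid_Mlc_circuit G \<longleftrightarrow>
     card (edges G) + card (loops G) = 2 * card (verts G) + 1 \<and>
     (\<forall>X. X \<subseteq> verts G \<and> card X \<ge> 2 \<longrightarrow> i_edges G X \<le> 2 * card X - 3) \<and>
     (\<forall>X. X \<subset> verts G \<longrightarrow> i_all G X \<le> 2 * card X)"

definition is_K1_3 :: "'a lgraph \<Rightarrow> bool" where
  "is_K1_3 G \<longleftrightarrow>
     (\<exists>v. verts G = {v} \<and> edges G = {} \<and> card (loops G) = 3 \<and> (\<forall>l\<in>loops G. fst l = v))"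

text \<open>
  \<open>one_extension G H\<close>: the graph \<open>H\<close> is a 1-extension of \<open>G\<close>. The first two rules are
  the 1-extensions at the edge \<open>uw\<close>, the last two those at a loop \<open>l\<close>
  with end-vertex \<open>u\<close>.
\<close>

inductive one_extension :: "'a lgraph \<Rightarrow> 'a lgraph \<Rightarrow> bool" where
  edge_edge:
    "\<lbrakk>{u, w} \<in> edges G; u \<noteq> w; v \<notin> verts G; x \<in> verts G - {u, w}\<rbrakk> \<Longrightarrow>
     one_extension G
       \<lparr>verts = insert v (verts G),
        edges = (edges G - {{u, w}}) \<union> {{u, v}, {w, v}, {v, x}},
        loops = loops G\<rparr>"
| edge_loop:
    "\<lbrakk>{u, w} \<in> edges G; u \<noteq> w; v \<notin> verts G\<rbrakk> \<Longrightarrow>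
     one_extension G
       \<lparr>verts = insert v (verts G),
        edges = (edges G - {{u, w}}) \<union> {{u, v}, {w, v}},
        loops = loops G \<union> {(v, i)}\<rparr>"
| loop_edge:
    "\<lbrakk>l \<in> loops G; fst l = u; v \<notin> verts G; w \<in> verts G - {u}\<rbrakk> \<Longrightarrow>
     one_extension G
       \<lparr>verts = insert v (verts G),
        edges = edges G \<union> {{u, v}, {w, v}},
        loops = (loops G - {l}) \<union> {(v, i)}\<rparr>"
| loop_loop:
    "\<lbrakk>l \<in> loops G; fst l = u; v \<notin> verts G; i \<noteq> j\<rbrakk> \<Longrightarrow>
     one_extension G
       \<lparr>verts = insert v (verts G),
        edges = edges G \<union> {{u, v}},
        loops = (loops G - {l}) \<union> {(v, i), (v, j)}\<rparr>"

definition two_sum :: "'a lgraph \<Rightarrow> 'a lgraph \<Rightarrow> 'a \<Rightarrow> 'a \<Rightarrow> 'a lgraph \<Rightarrow> bool" where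
  "two_sum G1 G2 u v G \<longleftrightarrow>
     looped_simple_graph G1 \<and> looped_simple_graph G2 \<and>
     verts G1 \<union> verts G2 = verts G \<and>
     verts G1 \<inter> verts G2 = {u, v} \<and>
     edges G1 \<inter> edges G2 = {{u, v}} \<and>
     edges G = (edges G1 \<union> edges G2) - {{u, v}} \<and>
     loops G = loops G1 \<union> loops G2 \<and>
     loops G1 \<inter> loops G2 = {}"

definition is_K4 :: "'a lgraph \<Rightarrow> bool" where
  "is_K4 G \<longleftrightarrow>
     card (verts G) = 4 \<and> edges G = {e. e \<subseteq> verts G \<and> card e = 2} \<and> loops G = {}"

definition K4_extension :: "'a lgraph \<Rightarrow> 'a lgraph \<Rightarrow> bool" where
  "K4_extension G1 G \<longleftrightarrow> (\<exists>K u v. is_K4 K \<and> two_sum G1 K u v G)"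

text \<open>
  New vertices, the initial vertex and loop labels are all arbitrary in the rules, so no separate
  closure under isomorphism is needed.
\<close>

inductive constructible :: "'a lgraph \<Rightarrow> bool" where
  K1_3: "is_K1_3 G \<Longrightarrow> constructible G"
| one_ext: "\<lbrakk>constructible G; one_extension G H\<rbrakk> \<Longrightarrow> constructible H"
| K4_ext: "\<lbrakk>constructible G; K4_extension G H\<rbrakk> \<Longrightarrow> constructible H"

end

theory Submission
  imports Defs
begin

text \<open>
  Write \<open>f X = 2 |X| - i(X)\<close>. Both \<open>f\<close> and its analogue for the edge count are submodular; call a
  proper subset with \<open>f X = 0\<close> full, and a set of at least two vertices meeting the edge bound with
  equality rigid. A 1-reduction at a vertex of degree 3 (a node) that inserts the edge \<open>xy\<close> or a loop
  at \<open>x\<close> can only be blocked by a full or rigid set around the ends of the inserted element.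
  The nodes induce a forest. If every vertex is a node, a leaf of this forest carries two loops and can
  be reduced. Otherwise take a full set \<open>X\<close>, possibly empty, that is maximal subject to its complement
  containing a vertex that is not a node, and a leaf \<open>v\<close> of the forest induced by the nodes outside
  \<open>X\<close>. The union of \<open>X\<close> with a full blocking set is again full, so by maximality everything outside it
  is a node; as \<open>v\<close> has at most one neighbour outside \<open>X\<close> that is a node, hardly any blocking set is
  full, and uncrossing the rigid ones leaves a copy of \<open>K\<^sub>4\<close> glued along a non-edge as the only
  obstruction.
\<close>

section \<open>Edge and loop counts\<close>

definition nbrs :: "'a lgraph \<Rightarrow> 'a \<Rightarrow> 'a set" where
  "nbrs G v = {w. {v, w} \<in> edges G}"

definition loops_at :: "'a lgraph \<Rightarrow> 'a \<Rightarrow> 'a loop set" where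
  "loops_at G v = {l \<in> loops G. fst l = v}"

text \<open>A loop contributes one, not two, so in a looped simple graph \<open>deg G v\<close> is
  the number of edges and loops lost when \<open>v\<close> is deleted.\<close>

definition deg :: "'a lgraph \<Rightarrow> 'a \<Rightarrow> nat" where
  "deg G v = card (nbrs G v) + card (loops_at G v)"

locale lsgraph =
  fixes G :: "'a lgraph"
  assumes graph: "looped_simple_graph G"
begin

abbreviation "V \<equiv> verts G"
abbreviation "E \<equiv> edges G"
abbreviation "L \<equiv> loops G"

lemma finite_V [simp]: "finite V" and finite_L [simp]: "finite L"
  using graph by (auto simp: looped_simple_graph_def)

lemma edge_subset: "e \<in> E \<Longrightarrow> e \<subseteq> V" and edge_card: "e \<in> E \<Longrightarrow> card e = 2"
  using graph by (auto simp: looped_simple_graph_def)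

lemma loop_vertex: "l \<in> L \<Longrightarrow> fst l \<in> V"
  using graph by (auto simp: looped_simple_graph_def)

lemma finite_E [simp]: "finite E"
  by (rule finite_subset[of _ "Pow V"]) (use edge_subset in auto)

lemma finite_loops_at [simp]: "finite (loops_at G v)"
  by (simp add: loops_at_def)

lemma nbrs_subset: "nbrs G v \<subseteq> V"
  using edge_subset by (auto simp: nbrs_def)

lemma finite_nbrs [simp]: "finite (nbrs G v)"
  using nbrs_subset finite_subset finite_V by blast

lemma not_nbr_self [simp]: "v \<notin> nbrs G v"
  using edge_card[of "{v}"] by (auto simp: nbrs_def)

lemma nbrs_sym: "x \<in> nbrs G y \<longleftrightarrow> y \<in> nbrs G x"
  by (simp add: nbrs_def insert_commute)

lemma edge_at:
  assumes "e \<in> E" "v \<in> e"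
  obtains w where "e = {v, w}" "w \<noteq> v"
proof -
  obtain x y where "e = {x, y}" "x \<noteq> y"
    using edge_card[OF assms(1)] by (auto simp: card_2_iff)
  moreover from this have "v = x \<or> v = y" using assms(2) by simp
  ultimately show thesis using that by (metis insert_commute)
qed

section \<open>Counts after adding one vertex to a set\<close>

lemma i_edges_insert:
  assumes "v \<notin> X"
  shows "i_edges G (insert v X) = i_edges G X + card (nbrs G v \<inter> X)"
proof -
  have eq: "{e \<in> E. e \<subseteq> insert v X} = {e \<in> E. e \<subseteq> X} \<union> (\<lambda>w. {v, w}) ` (nbrs G v \<inter> X)" (is "?A = ?B \<union> ?C")
  proof (intro subset_antisym subsetI)
    fix e assume e: "e \<in> ?A"
    show "e \<in> ?B \<union> ?C"
    proof (cases "v \<in> e")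
      case True
      with e obtain w where "e = {v, w}" "w \<noteq> v" by (blast elim: edge_at)
      with e show ?thesis by (auto simp: nbrs_def)
    qed (use e in auto)
  qed (auto simp: nbrs_def)
  have "card ?C = card (nbrs G v \<inter> X)"
    using assms by (intro card_image inj_onI) (auto simp: doubleton_eq_iff)
  moreover have "?B \<inter> ?C = {}" using assms by auto
  ultimately show ?thesis
    unfolding i_edges_def eq by (subst card_Un_disjoint) auto
qed

lemma i_loops_insert:
  assumes "v \<notin> X"
  shows "i_loops G (insert v X) = i_loops G X + card (loops_at G v)"
proof -
  have "{l \<in> L. fst l \<in> insert v X} = {l \<in> L. fst l \<in> X} \<union> loops_at G v"
    by (auto simp: loops_at_def)
  moreover have "{l \<in> L. fst l \<in> X} \<inter> loops_at G v = {}"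
    using assms by (auto simp: loops_at_def)
  ultimately show ?thesis
    unfolding i_loops_def by (simp add: card_Un_disjoint)
qed

lemma i_all_insert:
  "v \<notin> X \<Longrightarrow> i_all G (insert v X) = i_all G X + card (nbrs G v \<inter> X) + card (loops_at G v)"
  by (simp add: i_all_def i_edges_insert i_loops_insert)

lemma i_edges_empty [simp]: "i_edges G {} = 0"
  using edge_card[of "{}"] by (auto simp: i_edges_def)

lemma i_loops_empty [simp]: "i_loops G {} = 0"
  by (simp add: i_loops_def)

lemma i_all_empty [simp]: "i_all G {} = 0"
  by (simp add: i_all_def)

lemma i_edges_singleton [simp]: "i_edges G {x} = 0"
  using i_edges_insert[of x "{}"] by simp

section \<open>Supermodularity of the edge count and modularity of the loop count\<close>

lemma i_edges_supermodular: "i_edges G X + i_edges G Y \<le> i_edges G (X \<union> Y) + i_edges G (X \<inter> Y)"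
proof -
  let ?A = "\<lambda>X. {e \<in> E. e \<subseteq> X}"
  have "i_edges G X + i_edges G Y = card (?A X \<union> ?A Y) + card (?A X \<inter> ?A Y)"
    unfolding i_edges_def by (rule card_Un_Int) auto
  also have "?A X \<inter> ?A Y = ?A (X \<inter> Y)" by auto
  also have "card (?A X \<union> ?A Y) \<le> card (?A (X \<union> Y))"
    by (rule card_mono) auto
  finally show ?thesis by (simp add: i_edges_def)
qed

text \<open>The edge \<open>{p, q}\<close> is induced by the union but by neither \<open>X\<close>
  nor \<open>Y\<close>, so the inclusion behind supermodularity becomes proper.\<close>

lemma i_edges_supermodular_strict:
  assumes "{p, q} \<in> E" "p \<in> X - Y" "q \<in> Y - X"
  shows "i_edges G X + i_edges G Y < i_edges G (X \<union> Y) + i_edges G (X \<inter> Y)"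
proof -
  let ?A = "\<lambda>X. {e \<in> E. e \<subseteq> X}"
  have "i_edges G X + i_edges G Y = card (?A X \<union> ?A Y) + card (?A X \<inter> ?A Y)"
    unfolding i_edges_def by (rule card_Un_Int) auto
  also have "?A X \<inter> ?A Y = ?A (X \<inter> Y)" by auto
  also have "card (?A X \<union> ?A Y) < card (?A (X \<union> Y))"
  proof (rule psubset_card_mono)
    have "{p, q} \<in> ?A (X \<union> Y)" "{p, q} \<notin> ?A X \<union> ?A Y" using assms by simp_all
    then have "?A X \<union> ?A Y \<noteq> ?A (X \<union> Y)" by metis
    then show "?A X \<union> ?A Y \<subset> ?A (X \<union> Y)" by (intro psubsetI) auto
  qed simp
  finally show ?thesis by (simp add: i_edges_def)
qed

text \<open>Sets meeting in a single vertex induce no common edge, so the three induced edge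
  families are pairwise disjoint.\<close>

lemma i_edges_three:
  assumes "A \<inter> B = {p}" "B \<inter> C = {q}" "A \<inter> C = {r}"
  shows "i_edges G A + i_edges G B + i_edges G C \<le> i_edges G (A \<union> B \<union> C)"
proof -
  let ?E = "\<lambda>X. {e \<in> E. e \<subseteq> X}"
  have disj: "?E X \<inter> ?E Y = {}" if "X \<inter> Y = {x}" for X Y x
  proof -
    have "e \<notin> ?E Y" if "e \<in> ?E X" for e
    proof
      assume "e \<in> ?E Y"
      with that \<open>X \<inter> Y = {x}\<close> have "e \<subseteq> {x}" "e \<in> E" by auto
      then show False using edge_card[of e] card_mono[of "{x}" e] by simp
    qed
    then show ?thesis by blast
  qed
  have "card (?E A) + card (?E B) + card (?E C) = card (?E A \<union> ?E B) + card (?E C)"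
    using disj[OF assms(1)] by (simp add: card_Un_disjoint)
  also have "\<dots> = card (?E A \<union> ?E B \<union> ?E C)"
    using disj[OF assms(2)] disj[OF assms(3)] by (simp add: card_Un_disjoint Int_Un_distrib2)
  also have "\<dots> \<le> card (?E (A \<union> B \<union> C))"
    by (rule card_mono) auto
  finally show ?thesis by (simp add: i_edges_def)
qed

text \<open>Equality holds, in contrast to edges, because a loop has one end-vertex and cannot run
  between \<open>X - Y\<close> and \<open>Y - X\<close>.\<close>

lemma i_loops_modular: "i_loops G X + i_loops G Y = i_loops G (X \<union> Y) + i_loops G (X \<inter> Y)"
proof -
  let ?A = "\<lambda>X. {l \<in> L. fst l \<in> X}"
  have "i_loops G X + i_loops G Y = card (?A X \<union> ?A Y) + card (?A X \<inter> ?A Y)"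
    unfolding i_loops_def by (rule card_Un_Int) auto
  also have "?A X \<inter> ?A Y = ?A (X \<inter> Y)" by auto
  also have "?A X \<union> ?A Y = ?A (X \<union> Y)" by auto
  finally show ?thesis by (simp add: i_loops_def)
qed

lemma i_loops_mono: "X \<subseteq> Y \<Longrightarrow> i_loops G X \<le> i_loops G Y"
  unfolding i_loops_def by (rule card_mono) auto

section \<open>Deletion of vertices and degree sums\<close>

lemma i_all_V: "i_all G V = card E + card L"
proof -
  have "{e \<in> E. e \<subseteq> V} = E" "{l \<in> L. fst l \<in> V} = L"
    using edge_subset loop_vertex by auto
  then show ?thesis by (simp add: i_all_def i_edges_def i_loops_def)
qed

text \<open>The degree sum counts edges inside \<open>W\<close> twice and all other edges and loops
  meeting \<open>W\<close> once; the extra term on the left pays for the double count.\<close>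

lemma i_all_remove:
  assumes "W \<subseteq> V"
  shows "i_all G V + i_edges G W = i_all G (V - W) + (\<Sum>w\<in>W. deg G w)"
proof -
  have "finite W" using assms by (rule finite_subset) simp
  then show ?thesis using assms
  proof (induction W)
    case (insert w W)
    let ?U = "V - insert w W"
    have "nbrs G w = (nbrs G w \<inter> ?U) \<union> (nbrs G w \<inter> W)"
      using nbrs_subset[of w] not_nbr_self[of w] by auto
    also have "card \<dots> = card (nbrs G w \<inter> ?U) + card (nbrs G w \<inter> W)"
      by (rule card_Un_disjoint) auto
    finally have nb: "card (nbrs G w) = card (nbrs G w \<inter> ?U) + card (nbrs G w \<inter> W)" .
    have VW: "V - W = insert w ?U" using insert.prems insert.hyps by blast
    have "i_all G (V - W) = i_all G ?U + card (nbrs G w \<inter> ?U) + card (loops_at G w)"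
      unfolding VW by (rule i_all_insert) simp
    moreover have "i_all G V + i_edges G W = i_all G (V - W) + (\<Sum>w\<in>W. deg G w)"
      using insert.IH insert.prems by simp
    moreover have "(\<Sum>w\<in>insert w W. deg G w) = deg G w + (\<Sum>w\<in>W. deg G w)"
      using insert.hyps by (rule sum.insert)
    ultimately show ?case
      using nb i_edges_insert[OF insert.hyps(2)] by (simp only: deg_def)
  qed simp
qed

text \<open>A new vertex contributes its own term and raises the term of each neighbour in
  \<open>W\<close> by one, so its edges into \<open>W\<close> enter twice.\<close>

lemma handshake:
  assumes "finite W"
  shows "(\<Sum>w\<in>W. card (nbrs G w \<inter> W)) = 2 * i_edges G W"
  using assms
proof (induction W)
  case (insert v W)
  have "card (nbrs G w \<inter> insert v W) = card (nbrs G w \<inter> W) + (if w \<in> nbrs G v then 1 else 0)" for w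
  proof -
    have "w \<in> nbrs G v \<longleftrightarrow> v \<in> nbrs G w" by (rule nbrs_sym)
    then show ?thesis using insert(1,2) by simp
  qed
  then have "(\<Sum>w\<in>W. card (nbrs G w \<inter> insert v W))
      = (\<Sum>w\<in>W. card (nbrs G w \<inter> W)) + card (nbrs G v \<inter> W)"
    using insert(1) by (simp add: sum.distrib sum.If_cases Int_commute)
  with insert show ?case by (simp add: i_edges_insert)
qed simp

end

section \<open>Full and rigid sets in circuits\<close>

locale circuit = lsgraph +
  assumes circuit: "rigid_Mlc_circuit G"
begin

text \<open>Additive form of the edge bound, suited to linear arithmetic: with two vertices the
  truncated subtraction in the definition is a true one.\<close>

lemma i_edges_le:
  assumes "X \<subseteq> V" "2 \<le> card X"
  shows "i_edges G X + 3 \<le> 2 * card X"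
proof -
  have "i_edges G X \<le> 2 * card X - 3"
    using circuit assms unfolding rigid_Mlc_circuit_def by blast
  with assms(2) show ?thesis by linarith
qed

lemma i_all_le: "X \<subset> V \<Longrightarrow> i_all G X \<le> 2 * card X"
  using circuit unfolding rigid_Mlc_circuit_def by blast

lemma i_all_V_eq: "i_all G V = 2 * card V + 1"
  using circuit by (simp add: rigid_Mlc_circuit_def i_all_V)

lemma finite_sub: "X \<subseteq> V \<Longrightarrow> finite X"
  using finite_subset[OF _ finite_V] .

lemma card_V_split: "X \<subseteq> V \<Longrightarrow> card V = card X + card (V - X)"
  using card_Diff_subset[OF finite_sub, of X V] card_mono[OF finite_V, of X] by linarith

definition node :: "'a \<Rightarrow> bool" where
  "node v \<longleftrightarrow> v \<in> V \<and> deg G v = 3"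

definition full :: "'a set \<Rightarrow> bool" where
  "full X \<longleftrightarrow> X \<subset> V \<and> i_all G X = 2 * card X"

definition rigid :: "'a set \<Rightarrow> bool" where
  "rigid Z \<longleftrightarrow> Z \<subseteq> V \<and> 2 \<le> card Z \<and> i_edges G Z + 3 = 2 * card Z"

lemma full_subset: "full X \<Longrightarrow> X \<subset> V" and rigid_subset: "rigid Z \<Longrightarrow> Z \<subseteq> V"
  by (simp_all add: full_def rigid_def)

text \<open>Of the \<open>2 * card V + 1\<close> edges and loops, at most
  \<open>2 * card V - 2\<close> survive the deletion of \<open>v\<close>.\<close>

lemma deg_ge: assumes "v \<in> V" shows "3 \<le> deg G v"
proof -
  have "i_all G (V - {v}) \<le> 2 * card (V - {v})" using assms by (intro i_all_le) auto
  moreover have "i_all G V = i_all G (V - {v}) + deg G v"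
    using i_all_remove[of "{v}"] assms by simp
  moreover have "card V = 1 + card (V - {v})"
    using card_V_split[of "{v}"] assms by simp
  ultimately show ?thesis using i_all_V_eq by linarith
qed

section \<open>Uncrossing full and rigid sets\<close>

lemma card_Un_Int_V: "X \<subseteq> V \<Longrightarrow> Y \<subseteq> V \<Longrightarrow> card X + card Y = card (X \<union> Y) + card (X \<inter> Y)"
  by (intro card_Un_Int finite_sub)

text \<open>The function \<open>f\<close> vanishes on \<open>X\<close> and \<open>Y\<close> and is
  nonnegative on the proper subsets \<open>X \<union> Y\<close> and \<open>X \<inter> Y\<close>, so
  submodularity is an equality: the union is full and the strict version is excluded. On
  \<open>V\<close> itself \<open>f\<close> is -1, hence the condition on the union.\<close>

lemma full_Un:
  assumes "full X" "full Y" "X \<union> Y \<noteq> V"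
  shows "full (X \<union> Y)"
    and "p \<in> X - Y \<Longrightarrow> q \<in> Y - X \<Longrightarrow> {p, q} \<notin> E"
proof -
  have X: "X \<subset> V" and Y: "Y \<subset> V" using assms full_subset by auto
  have U: "X \<union> Y \<subset> V" and I: "X \<inter> Y \<subset> V" using X Y assms(3) by auto
  have "i_all G (X \<union> Y) \<le> 2 * card (X \<union> Y)" "i_all G (X \<inter> Y) \<le> 2 * card (X \<inter> Y)"
    using i_all_le U I by auto
  moreover have "i_all G X = 2 * card X" "i_all G Y = 2 * card Y"
    using assms by (simp_all add: full_def)
  moreover have "card X + card Y = card (X \<union> Y) + card (X \<inter> Y)"
    using X Y by (intro card_Un_Int_V) auto
  moreover note i_edges_supermodular[of X Y] i_loops_modular[of X Y]
  ultimately show "full (X \<union> Y)"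
    and "p \<in> X - Y \<Longrightarrow> q \<in> Y - X \<Longrightarrow> {p, q} \<notin> E"
    using U i_edges_supermodular_strict[of p q X Y] by (auto simp: full_def i_all_def)
qed

text \<open>The loops of \<open>X\<close> remain in the union, and the constant 3 in the edge bound
  for \<open>X \<inter> Z\<close> cancels the 3 by which the rigid set \<open>Z\<close> falls short
  of \<open>2 * card Z\<close>.\<close>

lemma full_Un_rigid:
  assumes "full X" "rigid Z" "2 \<le> card (X \<inter> Z)" "X \<union> Z \<noteq> V"
  shows "full (X \<union> Z)"
proof -
  have X: "X \<subset> V" and Z: "Z \<subseteq> V" using assms full_subset rigid_subset by auto
  have U: "X \<union> Z \<subset> V" and I: "X \<inter> Z \<subseteq> V" using X Z assms(4) by auto
  have "i_all G (X \<union> Z) \<le> 2 * card (X \<union> Z)" "i_edges G (X \<inter> Z) + 3 \<le> 2 * card (X \<inter> Z)"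
    using i_all_le U i_edges_le I assms(3) by auto
  moreover have "i_all G X = 2 * card X" "i_edges G Z + 3 = 2 * card Z"
    using assms by (simp_all add: full_def rigid_def)
  moreover have "card X + card Z = card (X \<union> Z) + card (X \<inter> Z)"
    using X Z by (intro card_Un_Int_V) auto
  moreover note i_edges_supermodular[of X Z] i_loops_mono[of X "X \<union> Z"]
  ultimately show ?thesis
    using U by (auto simp: full_def i_all_def)
qed

text \<open>With two common vertices the edge bound applies to the intersection as well as to the
  union, and supermodularity forces equality in both.\<close>

lemma rigid_Un:
  assumes "rigid Z" "rigid W" "2 \<le> card (Z \<inter> W)"
  shows "rigid (Z \<union> W)"
proof -
  have Z: "Z \<subseteq> V" and W: "W \<subseteq> V" using assms rigid_subset by auto
  have c: "2 \<le> card (Z \<union> W)"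
    using assms(3) card_mono[of "Z \<union> W" "Z \<inter> W"] Z W finite_sub by (simp add: le_infI1)
  have "i_edges G (Z \<union> W) + 3 \<le> 2 * card (Z \<union> W)" "i_edges G (Z \<inter> W) + 3 \<le> 2 * card (Z \<inter> W)"
    using i_edges_le[of "Z \<union> W"] i_edges_le[of "Z \<inter> W"] Z W c assms(3) by auto
  moreover have "i_edges G Z + 3 = 2 * card Z" "i_edges G W + 3 = 2 * card W"
    using assms by (simp_all add: rigid_def)
  moreover have "card Z + card W = card (Z \<union> W) + card (Z \<inter> W)"
    using Z W by (intro card_Un_Int_V) auto
  moreover note i_edges_supermodular[of Z W]
  ultimately show ?thesis
    using c Z W by (auto simp: rigid_def)
qed

text \<open>Three deficits of 3 add up to 9; the three shared vertices are each counted twice, which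
  returns 6 and leaves the deficit 3 of a rigid set.\<close>

lemma rigid_three:
  assumes "rigid A" "rigid B" "rigid C"
    and "A \<inter> B = {p}" "B \<inter> C = {q}" "A \<inter> C = {r}" "q \<noteq> r"
  shows "rigid (A \<union> B \<union> C)"
proof -
  have sub: "A \<subseteq> V" "B \<subseteq> V" "C \<subseteq> V" using assms rigid_subset by auto
  have fin: "finite A" "finite B" "finite C" using sub finite_sub by auto
  have ABC: "(A \<union> B) \<inter> C = {q, r}" using assms(5,6) by auto
  have "card A + card B = card (A \<union> B) + 1"
    using card_Un_Int[OF fin(1,2)] assms(4) by simp
  moreover have "card (A \<union> B) + card C = card (A \<union> B \<union> C) + 2"
    using card_Un_Int[of "A \<union> B" C] fin ABC assms(7) by simp
  moreover have "i_edges G A + i_edges G B + i_edges G C \<le> i_edges G (A \<union> B \<union> C)"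
    using assms(4-6) by (rule i_edges_three)
  moreover have c: "2 \<le> card (A \<union> B \<union> C)"
    using assms(1) card_mono[of "A \<union> B \<union> C" A] fin by (simp add: rigid_def le_supI1)
  moreover have "i_edges G (A \<union> B \<union> C) + 3 \<le> 2 * card (A \<union> B \<union> C)"
    using sub c by (intro i_edges_le) auto
  moreover have "i_edges G A + 3 = 2 * card A" "i_edges G B + 3 = 2 * card B" "i_edges G C + 3 = 2 * card C"
    using assms(1-3) by (simp_all add: rigid_def)
  ultimately have "i_edges G (A \<union> B \<union> C) + 3 = 2 * card (A \<union> B \<union> C)" by linarith
  then show ?thesis using c sub by (simp add: rigid_def)
qed

section \<open>Vertices attached to full and rigid sets\<close>

lemma full_insert:
  assumes "full X" "v \<in> V - X" "2 \<le> card (nbrs G v \<inter> X) + card (loops_at G v)" "insert v X \<noteq> V"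
  shows "full (insert v X)"
proof -
  have X: "X \<subset> V" using assms full_subset by auto
  have U: "insert v X \<subset> V" using X assms by auto
  then have "i_all G (insert v X) \<le> 2 * card (insert v X)" by (rule i_all_le)
  then show ?thesis
    using U assms finite_sub[of X] X by (auto simp: full_def i_all_insert)
qed

text \<open>All three edges and loops at \<open>v\<close> would be induced by
  \<open>insert v X\<close>, where a proper subset of \<open>V\<close> has room for only two
  more.\<close>

lemma full_nbrs:
  assumes "full X" "node v" "v \<notin> X" "nbrs G v \<subseteq> X"
  shows "insert v X = V"
proof (rule ccontr)
  assume "insert v X \<noteq> V"
  moreover have "X \<subset> V" using assms full_subset by auto
  ultimately have "i_all G (insert v X) \<le> 2 * card (insert v X)"
    using assms(2) by (intro i_all_le) (auto simp: node_def)
  moreover have "nbrs G v \<inter> X = nbrs G v" using assms by auto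
  ultimately show False
    using assms finite_sub[of X] by (auto simp: full_def node_def i_all_insert deg_def)
qed

text \<open>Adding \<open>v\<close> would bring three edges for one vertex and exceed the edge bound
  by one.\<close>

lemma rigid_nbrs:
  assumes "rigid Z" "node v" "v \<notin> Z" "card (nbrs G v) = 3"
  shows "\<not> nbrs G v \<subseteq> Z"
proof
  assume "nbrs G v \<subseteq> Z"
  then have "nbrs G v \<inter> Z = nbrs G v" by auto
  moreover have Z: "finite Z" "Z \<subseteq> V" using assms(1) rigid_subset finite_sub by auto
  then have "i_edges G (insert v Z) + 3 \<le> 2 * card (insert v Z)"
    using assms by (intro i_edges_le) (auto simp: rigid_def node_def)
  ultimately show False
    using assms Z by (auto simp: rigid_def i_edges_insert)
qed

text \<open>If at least two vertices remain without \<open>z\<close>, the edge bound on them forces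
  two edges at \<open>z\<close>; otherwise \<open>Z\<close> is a single edge.\<close>

lemma rigid_degree:
  assumes "rigid Z" "z \<in> Z"
  shows "nbrs G z \<inter> Z \<noteq> {}"
    and "card (nbrs G z \<inter> Z) = 1 \<Longrightarrow> card Z = 2"
proof -
  define Y where "Y = Z - {z}"
  have Z: "Z \<subseteq> V" "2 \<le> card Z" and rZ: "i_edges G Z + 3 = 2 * card Z"
    using assms by (auto simp: rigid_def)
  have ZY: "Z = insert z Y" "z \<notin> Y" "Y \<subseteq> V" using assms Z by (auto simp: Y_def)
  have c: "card Z = card Y + 1" using ZY finite_sub[of Y] by simp
  have "nbrs G z \<inter> Y = nbrs G z \<inter> Z" using ZY(1) by auto
  then have i: "i_edges G Z = i_edges G Y + card (nbrs G z \<inter> Z)"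
    using i_edges_insert[of z Y] ZY by simp
  have "card Y \<ge> 2 \<or> card Y = 1" using c Z(2) by linarith
  then have "(nbrs G z \<inter> Z \<noteq> {}) \<and> (card (nbrs G z \<inter> Z) = 1 \<longrightarrow> card Z = 2)"
  proof
    assume "2 \<le> card Y"
    with ZY(3) have "i_edges G Y + 3 \<le> 2 * card Y" by (rule i_edges_le)
    with i c rZ have "2 \<le> card (nbrs G z \<inter> Z)" by linarith
    then show ?thesis by auto
  next
    assume 1: "card Y = 1"
    then obtain y where "Y = {y}" by (auto simp: card_1_singleton_iff)
    then have "i_edges G Y = 0" by simp
    with i c rZ 1 have "card (nbrs G z \<inter> Z) = 1" "card Z = 2" by linarith+
    then show ?thesis by auto
  qed
  then show "nbrs G z \<inter> Z \<noteq> {}" and "card (nbrs G z \<inter> Z) = 1 \<Longrightarrow> card Z = 2" by auto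
qed

text \<open>Deleting \<open>W\<close> lowers the bound by 2 per vertex while the degree sum is 3 per
  vertex; with the surplus 1 of \<open>V\<close> this leaves fewer than \<open>card W\<close>
  induced edges. As it holds for every nonempty set of nodes, the nodes induce a forest.\<close>

lemma nodes_forest:
  assumes "W \<subseteq> V" "W \<noteq> {}" "\<And>w. w \<in> W \<Longrightarrow> node w"
  shows "i_edges G W + 1 \<le> card W"
proof -
  have "(\<Sum>w\<in>W. deg G w) = 3 * card W" using assms(3) by (simp add: node_def)
  moreover have "V - W \<subset> V" using assms by auto
  then have "i_all G (V - W) \<le> 2 * card (V - W)" by (rule i_all_le)
  moreover note card_V_split[OF assms(1)]
  ultimately show ?thesis using i_all_remove[OF assms(1)] i_all_V_eq by linarith
qed

text \<open>Otherwise \<open>handshake\<close> would give at least \<open>card W\<close> edges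
  inside \<open>W\<close>, against the forest bound.\<close>

lemma nodes_leaf:
  assumes "W \<subseteq> V" "W \<noteq> {}" "\<And>w. w \<in> W \<Longrightarrow> node w"
  obtains w where "w \<in> W" "card (nbrs G w \<inter> W) \<le> 1"
proof (rule ccontr)
  note fin = finite_sub[OF assms(1)]
  assume "\<not> thesis"
  with that have "\<And>w. w \<in> W \<Longrightarrow> 2 \<le> card (nbrs G w \<inter> W)" by fastforce
  then have "(\<Sum>w\<in>W. 2) \<le> (\<Sum>w\<in>W. card (nbrs G w \<inter> W))" by (rule sum_mono)
  then show False using nodes_forest[OF assms] handshake[OF fin] by simp
qed

text \<open>If all degrees outside \<open>X\<close> were at least 4, the complement
  \<open>?C\<close> would induce at least \<open>2 * card ?C - 1\<close> edges. A single vertex is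
  treated apart because the edge bound starts at two vertices.\<close>

lemma full_complement_node:
  assumes "full X"
  obtains v where "v \<in> V - X" "node v"
proof (rule ccontr)
  assume "\<not> thesis"
  with that have no: "\<And>v. v \<in> V - X \<Longrightarrow> 4 \<le> deg G v"
    using deg_ge by (fastforce simp: node_def)
  let ?C = "V - X"
  have X: "X \<subset> V" using assms full_subset by auto
  then have "V - ?C = X" by auto
  then have rm: "i_all G V + i_edges G ?C = i_all G X + (\<Sum>w\<in>?C. deg G w)"
    using i_all_remove[of ?C] by simp
  have "(\<Sum>w\<in>?C. 4) \<le> (\<Sum>w\<in>?C. deg G w)" using no by (rule sum_mono)
  then have s: "4 * card ?C \<le> (\<Sum>w\<in>?C. deg G w)" by simp
  have cV: "card V = card X + card ?C"
    using X by (intro card_V_split) simp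
  have "card ?C \<noteq> 0" using X by (simp add: psubset_eq) auto
  moreover have "card ?C \<noteq> 1"
  proof
    assume 1: "card ?C = 1"
    then obtain c where "?C = {c}" by (auto simp: card_1_singleton_iff)
    then have "i_edges G ?C = 0" by simp
    with s rm cV 1 i_all_V_eq assms show False by (simp add: full_def)
  qed
  ultimately have "2 \<le> card ?C" by linarith
  then have "i_edges G ?C + 3 \<le> 2 * card ?C" by (intro i_edges_le) auto
  with s rm cV i_all_V_eq assms show False by (simp add: full_def)
qed

section \<open>Reducible configurations\<close>

text \<open>With a second common vertex \<open>A \<union> B\<close> would be rigid and contain all
  neighbours of \<open>v\<close>.\<close>

lemma rigid_Int_at_node:
  assumes "node v" "nbrs G v = {a, b, r}" "card (nbrs G v) = 3"
    and "rigid A" "rigid B" "v \<notin> A" "v \<notin> B" "{a, r} \<subseteq> A" "{b, r} \<subseteq> B"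
  shows "A \<inter> B = {r}"
proof (rule ccontr)
  assume "A \<inter> B \<noteq> {r}"
  moreover have r: "r \<in> A \<inter> B" using assms by auto
  ultimately obtain t where t: "t \<in> A \<inter> B" "t \<noteq> r" by blast
  have "finite (A \<inter> B)" using rigid_subset[OF assms(4)] finite_sub[of A] by simp
  then have "card {r, t} \<le> card (A \<inter> B)" using r t by (intro card_mono) auto
  then have "rigid (A \<union> B)" using t(2) assms by (intro rigid_Un) auto
  then have "\<not> nbrs G v \<subseteq> A \<union> B" using assms by (intro rigid_nbrs) auto
  then show False using assms by auto
qed

text \<open>The three sets meet pairwise in single vertices, so their union is rigid and contains
  all neighbours of \<open>v\<close>.\<close>

lemma not_three_rigid_at_node:
  assumes "node v" "nbrs G v = {a, b, r}" "card (nbrs G v) = 3"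
    and "rigid A" "rigid B" "rigid C" "v \<notin> A" "v \<notin> B" "v \<notin> C"
    and "{a, r} \<subseteq> A" "{b, r} \<subseteq> B" "{a, b} \<subseteq> C"
  shows False
proof -
  have "a \<noteq> b" using assms(2,3) by (auto simp: card_insert_if split: if_splits)
  have 1: "A \<inter> B = {r}" using assms by (intro rigid_Int_at_node[of v a b r]) auto
  have 2: "B \<inter> C = {b}" using assms by (intro rigid_Int_at_node[of v r a b]) auto
  have 3: "A \<inter> C = {a}" using assms by (intro rigid_Int_at_node[of v r b a]) auto
  have "rigid (A \<union> B \<union> C)"
    using assms(4-6) 1 2 3 \<open>a \<noteq> b\<close>[symmetric] by (rule rigid_three)
  then have "\<not> nbrs G v \<subseteq> A \<union> B \<union> C" using assms by (intro rigid_nbrs) auto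
  then show False using assms by auto
qed

text \<open>The edge \<open>rv\<close> leaves \<open>A \<union> B\<close>, so \<open>r\<close> has degree one in both sets, which are therefore single edges.\<close>

lemma K4_at_node:
  assumes "node v" "nbrs G v = {a, b, r}" "card (nbrs G v) = 3" "node r"
    and "rigid A" "rigid B" "v \<notin> A" "v \<notin> B" "{a, r} \<subseteq> A" "{b, r} \<subseteq> B"
  shows "nbrs G r = {v, a, b}" "loops_at G r = {}"
proof -
  have ne: "a \<noteq> r" "b \<noteq> r" using assms(2,3) by (auto simp: card_insert_if split: if_splits)
  have AB: "A \<inter> B = {r}" using assms by (intro rigid_Int_at_node[of v a b r]) auto
  let ?A = "nbrs G r \<inter> A" and ?B = "nbrs G r \<inter> B"
  have v: "v \<in> nbrs G r" using assms(2) nbrs_sym[of r v] by auto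
  have "?A \<inter> ?B = nbrs G r \<inter> (A \<inter> B)" by auto
  then have disj: "?A \<inter> ?B = {}" by (simp add: AB)
  have ne0: "?A \<noteq> {}" "?B \<noteq> {}" using rigid_degree(1) assms by auto
  have "card (insert v (?A \<union> ?B)) = 1 + card ?A + card ?B"
    using assms(7,8) disj by (simp add: card_Un_disjoint)
  moreover have "card (insert v (?A \<union> ?B)) \<le> card (nbrs G r)"
    using v by (intro card_mono) auto
  moreover have "card (nbrs G r) + card (loops_at G r) = 3" using assms(4) by (simp add: node_def deg_def)
  moreover have "card ?A \<noteq> 0" "card ?B \<noteq> 0" using ne0 by simp_all
  ultimately have c: "card ?A = 1" "card ?B = 1" "card (loops_at G r) = 0" "card (nbrs G r) = card (insert v (?A \<union> ?B))"
    by linarith+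
  have N: "insert v (?A \<union> ?B) = nbrs G r"
    using v c(4) by (intro card_subset_eq) auto
  have fin: "finite A" "finite B" using rigid_subset finite_sub assms(5,6) by blast+
  have "card A = 2" "card B = 2"
    using rigid_degree(2)[OF assms(5), of r] rigid_degree(2)[OF assms(6), of r] assms(9,10) c by simp_all
  then have "card {a, r} = card A" "card {b, r} = card B" using ne by simp_all
  then have "{a, r} = A" "{b, r} = B"
    using card_subset_eq[OF fin(1) assms(9)] card_subset_eq[OF fin(2) assms(10)] by blast+
  then have "?A \<subseteq> {a}" "?B \<subseteq> {b}" using not_nbr_self[of r] by blast+
  with ne0 have "?A = {a}" "?B = {b}" by auto
  with N show "nbrs G r = {v, a, b}" by auto
  show "loops_at G r = {}" using c(3) by simp
qed

text \<open>The cases \<open>loop\<close> and \<open>edge\<close> say that nothing blocks inserting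
  a loop at \<open>x\<close> or the edge \<open>{x, y}\<close> once \<open>v\<close> is deleted.
  Full sets are excluded only as proper subsets of \<open>V - {v}\<close>: that whole set is always
  full and must gain one element.\<close>

lemma reduction_cases:
  assumes "c \<in> V" "\<not> node c"
  obtains
    (loop) v x y where "node v" "nbrs G v = {x, y}" "x \<noteq> y" "card (loops_at G v) = 1"
      "\<And>Y. full Y \<Longrightarrow> x \<in> Y \<Longrightarrow> \<not> Y \<subset> V - {v}"
  | (edge) v x y z where "node v" "nbrs G v = {x, y, z}" "card (nbrs G v) = 3"
      "\<And>Y. full Y \<Longrightarrow> {x, y} \<subseteq> Y \<Longrightarrow> \<not> Y \<subset> V - {v}"
      "\<And>Z. rigid Z \<Longrightarrow> {x, y} \<subseteq> Z \<Longrightarrow> \<not> Z \<subseteq> V - {v}"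
  | (K4) v w x y where "node v" "node w" "nbrs G v = {w, x, y}" "nbrs G w = {v, x, y}" "x \<noteq> y"
      "loops_at G v = {}" "loops_at G w = {}"
proof -
  define P where "P X \<longleftrightarrow> full X \<and> (\<exists>c\<in>V-X. \<not> node c)" for X
  \<comment> \<open>The empty set is full, and \<open>c\<close> is a non-node in its
    complement.\<close>
  have "P {}" using assms by (auto simp: P_def full_def)
  moreover have "\<forall>Y. P Y \<longrightarrow> card Y < card V + 1"
  proof (intro allI impI)
    fix Y assume "P Y"
    then have "Y \<subseteq> V" by (simp add: P_def full_def psubset_imp_subset)
    then show "card Y < card V + 1" using card_mono[OF finite_V] by (simp add: less_Suc_eq_le)
  qed
  ultimately have "\<exists>X. P X \<and> (\<forall>Y. P Y \<longrightarrow> card Y \<le> card X)"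
    by (intro ex_has_greatest_nat)
  then obtain X where PX: "P X" and gr: "\<And>Y. P Y \<Longrightarrow> card Y \<le> card X" by blast
  have fX: "full X" and XV: "X \<subset> V" using PX full_subset by (auto simp: P_def)
  obtain d where d: "d \<in> V - X" "\<not> node d" using PX by (auto simp: P_def)
  have max: "node c" if "full Y" "X \<subset> Y" "c \<in> V - Y" for Y c
  proof (rule ccontr)
    assume "\<not> node c"
    with that have "card Y \<le> card X" by (intro gr) (auto simp: P_def)
    moreover have "card X < card Y"
      using that(1,2) full_subset[of Y] finite_sub[of Y] by (intro psubset_card_mono) auto
    ultimately show False by simp
  qed
  define W where "W = {w \<in> V - X. node w}"
  obtain w0 where "w0 \<in> V - X" "node w0" using full_complement_node[OF fX] .
  then have "W \<noteq> {}" by (auto simp: W_def)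
  moreover have "W \<subseteq> V" by (auto simp: W_def)
  moreover have "node w" if "w \<in> W" for w using that by (simp add: W_def)
  ultimately obtain v where "v \<in> W" and leaf: "card (nbrs G v \<inter> W) \<le> 1"
    using nodes_leaf[of W] by metis
  then have v: "v \<in> V - X" "node v" by (auto simp: W_def)
  have uniq: "a = b" if "a \<in> nbrs G v" "b \<in> nbrs G v" "a \<notin> X" "b \<notin> X" "node a" "node b" for a b
  proof -
    have "a \<in> nbrs G v \<inter> W" "b \<in> nbrs G v \<inter> W"
      using that nbrs_subset[of v] by (auto simp: W_def)
    then show ?thesis using leaf card_le_Suc0_iff_eq[of "nbrs G v \<inter> W"] by simp
  qed
  \<comment> \<open>Otherwise \<open>insert v X\<close> would be a larger full set whose complement
    still contains the non-node \<open>d\<close>.\<close>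
  have conn: "card (nbrs G v \<inter> X) + card (loops_at G v) \<le> 1"
  proof (rule ccontr)
    assume "\<not> ?thesis"
    moreover have "d \<noteq> v" using d v by auto
    then have "insert v X \<noteq> V" using d by auto
    ultimately have "full (insert v X)" using fX v by (intro full_insert) auto
    then have "node d" using d v \<open>d \<noteq> v\<close> by (intro max[of "insert v X"]) auto
    with d show False by simp
  qed
  \<comment> \<open>The point \<open>p\<close> makes \<open>X \<union> Y\<close> strictly larger
    than \<open>X\<close>, while \<open>v\<close> keeps it different from \<open>V\<close>;
    maximality applies.\<close>
  have miss: "node r" if "full Y" "v \<notin> Y" "p \<in> Y - X" "r \<in> V" "r \<notin> X \<union> Y" for Y p r
  proof -
    have "full (X \<union> Y)" using fX that v by (intro full_Un) auto
    then show ?thesis using that by (intro max[of "X \<union> Y"]) auto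
  qed
  have nV: "a \<in> V" if "a \<in> nbrs G v" for a using that nbrs_subset by auto
  have deg: "card (nbrs G v) + card (loops_at G v) = 3" using v by (simp add: node_def deg_def)
  show thesis
  proof (cases "card (loops_at G v) = 0")
    case False
    then have l1: "card (loops_at G v) = 1" and "card (nbrs G v \<inter> X) = 0" and n2: "card (nbrs G v) = 2"
      using conn deg by linarith+
    then have nX: "nbrs G v \<inter> X = {}" by simp
    have "\<exists>x y. nbrs G v = {x, y} \<and> x \<noteq> y \<and> \<not> node y"
    proof -
      obtain x y where xy: "nbrs G v = {x, y}" "x \<noteq> y" using n2 by (auto simp: card_2_iff)
      then have "\<not> node x \<or> \<not> node y" using uniq[of x y] nX by auto
      with xy show ?thesis by (metis insert_commute)
    qed
    then obtain x y where xy: "nbrs G v = {x, y}" "x \<noteq> y" "\<not> node y" by blast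
    \<comment> \<open>The loop goes to the neighbour opposite the non-node \<open>y\<close>: a
      blocking set omits \<open>y\<close> by \<open>full_nbrs\<close>, and \<open>miss\<close> would
      then make \<open>y\<close> a node.\<close>
    have "\<not> Y \<subset> V - {v}" if "full Y" "x \<in> Y" for Y
    proof
      assume Y: "Y \<subset> V - {v}"
      then have "insert v Y \<noteq> V" "v \<notin> Y" by auto
      then have "y \<notin> Y" using full_nbrs[of Y v] that v xy by auto
      then have "node y" using that xy nX nV \<open>v \<notin> Y\<close> by (intro miss[of Y x]) auto
      with xy show False by simp
    qed
    then show thesis using loop[OF v(2) xy(1,2) l1] by blast
  next
    case True
    then have n3: "card (nbrs G v) = 3" and l0: "loops_at G v = {}" using deg by simp_all
    have nX: "a = b" if "a \<in> nbrs G v \<inter> X" "b \<in> nbrs G v \<inter> X" for a b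
      using that conn card_le_Suc0_iff_eq[of "nbrs G v \<inter> X"] by simp
    show thesis
    proof (rule ccontr)
      assume no: "\<not> thesis"
      have noK4: False if "nbrs G v = {a, b, r}" "node r"
        "rigid A" "rigid B" "v \<notin> A" "v \<notin> B" "{a, r} \<subseteq> A" "{b, r} \<subseteq> B" for a b r A B
      proof -
        have "a \<noteq> b" using that n3 by (auto simp: card_insert_if split: if_splits)
        moreover have "nbrs G v = {r, a, b}" using that by auto
        moreover note K4_at_node[OF v(2) that(1) n3 that(2-)]
        ultimately show False using no K4[of v r a b] v that l0 by blast
      qed
      \<comment> \<open>The case \<open>edge\<close> fails for every ordering of the neighbours, so
        each pair is blocked; a blocking set cannot contain the third neighbour as well.\<close>
      have blocked: "(\<exists>Y. full Y \<and> v \<notin> Y \<and> {a, b} \<subseteq> Y \<and> r \<notin> Y) \<or> (\<exists>Z. rigid Z \<and> v \<notin> Z \<and> {a, b} \<subseteq> Z \<and> r \<notin> Z)"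
        if N: "nbrs G v = {a, b, r}" for a b r
      proof -
        consider Y where "full Y" "{a, b} \<subseteq> Y" "Y \<subset> V - {v}" | Z where "rigid Z" "{a, b} \<subseteq> Z" "Z \<subseteq> V - {v}"
          using edge[OF v(2) N n3] no by blast
        then show ?thesis
        proof cases
          case (1 Y)
          then have Y: "insert v Y \<noteq> V" "v \<notin> Y" by auto
          then have "\<not> nbrs G v \<subseteq> Y" using full_nbrs[OF 1(1) v(2)] by auto
          then have "r \<notin> Y" using 1(2) N by auto
          then show ?thesis using 1 Y by auto
        next
          case (2 Z)
          then have "v \<notin> Z" by auto
          then have "\<not> nbrs G v \<subseteq> Z" using rigid_nbrs[OF 2(1) v(2) _ n3] by auto
          then have "r \<notin> Z" using 2(2) N by auto
          then show ?thesis using 2 \<open>v \<notin> Z\<close> by auto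
        qed
      qed
      \<comment> \<open>At most one neighbour of \<open>v\<close> lies in \<open>X\<close>, so
        \<open>Y\<close> contains a point outside \<open>X\<close> and \<open>miss\<close>
        applies.\<close>
      have fullmiss: "r \<in> X \<or> node r"
        if "nbrs G v = {a, b, r}" "full Y" "v \<notin> Y" "{a, b} \<subseteq> Y" "r \<notin> Y" for a b r Y
      proof (cases "r \<in> X")
        case False
        have "a \<noteq> b" using that n3 by (auto simp: card_insert_if split: if_splits)
        then have "a \<notin> X \<or> b \<notin> X" using nX[of a b] that(1) by auto
        then have "\<exists>p. p \<in> Y - X" using that(4) by auto
        then obtain p where "p \<in> Y - X" ..
        then show ?thesis using that nV[of r] False by (intro disjI2 miss[of Y p]) auto
      qed simp
      \<comment> \<open>Hence only a rigid set can block the pair opposite a non-node outside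
        \<open>X\<close>.\<close>
      have rig: "\<exists>Z. rigid Z \<and> v \<notin> Z \<and> {a, b} \<subseteq> Z \<and> r \<notin> Z"
        if "nbrs G v = {a, b, r}" "r \<notin> X" "\<not> node r" for a b r
        using blocked[OF that(1)] fullmiss[OF that(1)] that by blast
      show False
      proof (cases "nbrs G v \<inter> X = {}")
        case True
        \<comment> \<open>All neighbours lie outside \<open>X\<close>, so by \<open>uniq\<close> at
          most one of the three is a node; it is called \<open>z\<close> if it exists.\<close>
        have "\<exists>x y z. nbrs G v = {x, y, z} \<and> \<not> node x \<and> \<not> node y"
        proof -
          obtain x y z where xyz: "nbrs G v = {x, y, z}" "x \<noteq> y" "y \<noteq> z" "x \<noteq> z"
            using n3 by (auto simp: card_3_iff)
          then have "\<not> node x \<and> \<not> node y \<or> \<not> node x \<and> \<not> node z \<or> \<not> node z \<and> \<not> node y"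
            using uniq[of x y] uniq[of y z] uniq[of x z] True by auto
          moreover have "nbrs G v = {x, z, y}" "nbrs G v = {z, y, x}" using xyz by auto
          ultimately show ?thesis using xyz(1) by blast
        qed
        then obtain x y z where N: "nbrs G v = {x, y, z}" and nn: "\<not> node x" "\<not> node y" by blast
        have N': "nbrs G v = {y, z, x}" "nbrs G v = {x, z, y}" using N by auto
        obtain A where A: "rigid A" "v \<notin> A" "{x, z} \<subseteq> A" using rig[OF N'(2)] True N nn by auto
        obtain B where B: "rigid B" "v \<notin> B" "{y, z} \<subseteq> B" using rig[OF N'(1)] True N nn by auto
        show False
        proof (cases "node z")
          case True
          then show False using noK4[OF N] A B by blast
        next
          case False
          then obtain C where "rigid C" "v \<notin> C" "{x, y} \<subseteq> C" using rig[OF N] True N by auto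
          then show False using not_three_rigid_at_node[OF v(2) N n3] A B by blast
        qed
      next
        case False
        have "\<exists>x y z. nbrs G v = {x, y, z} \<and> z \<in> X \<and> x \<notin> X \<and> y \<notin> X \<and> \<not> node x"
        proof -
          obtain z where z: "z \<in> nbrs G v" "z \<in> X" using False by auto
          then have "card (nbrs G v - {z}) = 2" using n3 by simp
          then obtain x y where xy: "nbrs G v - {z} = {x, y}" "x \<noteq> y" by (auto simp: card_2_iff)
          then have N: "nbrs G v = {x, y, z}" "nbrs G v = {y, x, z}" "x \<noteq> z" "y \<noteq> z" using z by auto
          then have "x \<notin> X" "y \<notin> X" using nX[of x z] nX[of y z] z by auto
          moreover from this have "\<not> node x \<or> \<not> node y" using uniq[of x y] xy N by auto
          ultimately show ?thesis using N z by blast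
        qed
        then obtain x y z where N: "nbrs G v = {x, y, z}" and zX: "z \<in> X" and xX: "x \<notin> X"
          and yX: "y \<notin> X" and nn: "\<not> node x" by blast
        have N': "nbrs G v = {y, z, x}" "nbrs G v = {x, z, y}" "nbrs G v = {z, x, y}" using N by auto
        obtain B where B: "rigid B" "v \<notin> B" "{y, z} \<subseteq> B" "x \<notin> B" using rig[OF N'(1)] xX nn by auto
        \<comment> \<open>With two common vertices \<open>X \<union> B\<close> would be a larger
          full set avoiding the non-node \<open>x\<close>.\<close>
        have BX: "X \<inter> B = {z}"
        proof (rule ccontr)
          assume "X \<inter> B \<noteq> {z}"
          then obtain t where t: "t \<in> X \<inter> B" "t \<noteq> z" using B zX by blast
          have "finite (X \<inter> B)" using finite_sub[of X] XV by auto
          then have "card {z, t} \<le> card (X \<inter> B)" using t B zX by (intro card_mono) auto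
          then have "full (X \<union> B)" using t(2) fX B v by (intro full_Un_rigid) auto
          then have "node x" using B yX xX N nV[of x] by (intro max[of "X \<union> B"]) auto
          with nn show False by simp
        qed
        from blocked[OF N] show False
        proof (elim disjE exE conjE)
          \<comment> \<open>The sets \<open>X\<close> and \<open>Y\<close> together contain all
            neighbours of \<open>v\<close>, so they cover \<open>V - {v}\<close>. A neighbour
            \<open>t\<close> of \<open>z\<close> inside the rigid set \<open>B\<close> then lies in
            \<open>Y - X\<close>, but uncrossing forbids the edge from \<open>z\<close> to
            \<open>t\<close>.\<close>
          fix Y assume Y: "full Y" "v \<notin> Y" "{x, y} \<subseteq> Y" "z \<notin> Y"
          have ne: "X \<union> Y \<noteq> V" using v Y by auto
          have "full (X \<union> Y)" using fX Y(1) ne by (rule full_Un)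
          then have XY: "insert v (X \<union> Y) = V" using v Y N zX by (intro full_nbrs) auto
          obtain t where t: "t \<in> nbrs G z" "t \<in> B" using rigid_degree(1)[OF B(1), of z] B by auto
          then have "t \<noteq> z" by auto
          then have "t \<notin> X" using BX t by auto
          moreover have "t \<in> V" "t \<noteq> v" using t nbrs_subset[of z] B by auto
          ultimately have "t \<in> Y - X" using XY by auto
          then have "{z, t} \<notin> E" using full_Un(2)[OF fX Y(1) ne, of z t] zX Y by auto
          then show False using t by (simp add: nbrs_def)
        next
          \<comment> \<open>Both \<open>B\<close> and \<open>C\<close> contain \<open>y\<close>: a
            node \<open>y\<close> gives the K4 configuration, a non-node \<open>y\<close> yields a
            third rigid set.\<close>
          fix C assume C: "rigid C" "v \<notin> C" "{x, y} \<subseteq> C" "z \<notin> C"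
          show False
          proof (cases "node y")
            case True
            have "{z, y} \<subseteq> B" using B by auto
            then show False using noK4[OF N'(2) True C(1) B(1)] C B by blast
          next
            case False
            then obtain A where "rigid A" "v \<notin> A" "{x, z} \<subseteq> A" using rig[OF N'(2)] yX by auto
            then show False using not_three_rigid_at_node[OF v(2) N n3] C B by blast
          qed
        qed
      qed
    qed
  qed
qed

section \<open>Inverse 1-extensions\<close>

lemma edges_split: "E = {e \<in> E. v \<notin> e} \<union> (\<lambda>a. {a, v}) ` nbrs G v"
proof -
  have "e \<in> (\<lambda>a. {a, v}) ` nbrs G v" if e: "e \<in> E" "v \<in> e" for e
  proof -
    obtain w where "e = {v, w}" using edge_at[OF e] .
    then have "e = {w, v}" "w \<in> nbrs G v" using e(1) by (auto simp: nbrs_def)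
    then show ?thesis by blast
  qed
  moreover have "(\<lambda>a. {a, v}) ` nbrs G v \<subseteq> E" by (auto simp: nbrs_def insert_commute)
  ultimately show ?thesis by auto
qed

lemma loops_split: "L = {l \<in> L. fst l \<noteq> v} \<union> loops_at G v"
  by (auto simp: loops_at_def)

lemma fresh_loop: obtains k where "(x, k) \<notin> L"
proof -
  have "finite (snd ` L)" by simp
  then obtain k where "k \<notin> snd ` L" using ex_new_if_finite infinite_UNIV_nat by blast
  then have "(x, k) \<notin> L" by force
  then show thesis by (rule that)
qed

text \<open>Deleting a node lowers the total by 3 and twice the vertex number by 2; the inserted
  element restores the surplus 1. Elsewhere a gain of one is allowed only on sets that are not tight
  and so have room for it.\<close>

lemma reduced_circuit:
  assumes "node v" "looped_simple_graph G'" "verts G' = V - {v}"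
    and "\<And>Z. Z \<subseteq> V - {v} \<Longrightarrow> i_edges G' Z \<le> i_edges G Z \<or> i_edges G' Z \<le> i_edges G Z + 1 \<and> \<not> rigid Z"
    and "\<And>X. X \<subset> V - {v} \<Longrightarrow> i_all G' X \<le> i_all G X \<or> i_all G' X \<le> i_all G X + 1 \<and> \<not> full X"
    and "i_all G' (V - {v}) = i_all G (V - {v}) + 1"
  shows "rigid_Mlc_circuit G'"
  unfolding rigid_Mlc_circuit_def assms(3)
proof (intro conjI allI impI; (elim conjE)?)
  interpret G': lsgraph G' using assms(2) by unfold_locales
  have v: "v \<in> V" "deg G v = 3" using assms(1) by (auto simp: node_def)
  have "i_all G V = i_all G (V - {v}) + 3" using i_all_remove[of "{v}"] v by simp
  moreover have "card V = 1 + card (V - {v})" using card_V_split[of "{v}"] v by simp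
  ultimately show "card (edges G') + card (loops G') = 2 * card (V - {v}) + 1"
    using i_all_V_eq assms(6) G'.i_all_V assms(3) by simp
next
  fix Z assume Z: "Z \<subseteq> V - {v}" "2 \<le> card Z"
  have ZV: "Z \<subseteq> V" using Z by auto
  have "i_edges G Z + 3 \<le> 2 * card Z" using ZV Z(2) by (rule i_edges_le)
  moreover have "i_edges G Z + 3 \<noteq> 2 * card Z" if "\<not> rigid Z"
    using that ZV Z(2) by (simp add: rigid_def)
  ultimately show "i_edges G' Z \<le> 2 * card Z - 3" using assms(4)[OF Z(1)] by auto
next
  fix X assume X: "X \<subset> V - {v}"
  have XV: "X \<subset> V" using X by auto
  have "i_all G X \<le> 2 * card X" using XV by (rule i_all_le)
  moreover have "i_all G X \<noteq> 2 * card X" if "\<not> full X"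
    using that XV by (simp add: full_def)
  ultimately show "i_all G' X \<le> 2 * card X" using assms(5)[OF X] by auto
qed

section \<open>Candidate graphs for the inverse 1-extensions\<close>

definition remove_add_loop :: "'a \<Rightarrow> 'a loop \<Rightarrow> 'a lgraph" where
  "remove_add_loop v l =
     \<lparr>verts = V - {v}, edges = {e \<in> E. v \<notin> e}, loops = insert l {l \<in> L. fst l \<noteq> v}\<rparr>"

definition remove_add_edge :: "'a \<Rightarrow> 'a set \<Rightarrow> 'a lgraph" where
  "remove_add_edge v d =
     \<lparr>verts = V - {v}, edges = insert d {e \<in> E. v \<notin> e}, loops = {l \<in> L. fst l \<noteq> v}\<rparr>"

text \<open>A loop does not enter the edge counts, so only full sets containing \<open>x\<close>
  could obstruct.\<close>

lemma remove_add_loop_circuit: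
  assumes "node v" "x \<in> V - {v}" "(x, k) \<notin> L"
    and "\<And>Y. full Y \<Longrightarrow> x \<in> Y \<Longrightarrow> \<not> Y \<subset> V - {v}"
  shows "looped_simple_graph (remove_add_loop v (x, k))" "rigid_Mlc_circuit (remove_add_loop v (x, k))"
proof -
  let ?G = "remove_add_loop v (x, k)"
  show lsg: "looped_simple_graph ?G"
    using assms(2) edge_subset edge_card loop_vertex
    by (auto simp: looped_simple_graph_def remove_add_loop_def)
  have ie: "i_edges ?G X = i_edges G X" if "X \<subseteq> V - {v}" for X
  proof -
    have "{e \<in> edges ?G. e \<subseteq> X} = {e \<in> E. e \<subseteq> X}" using that by (auto simp: remove_add_loop_def)
    then show ?thesis by (simp add: i_edges_def)
  qed
  have il: "i_loops ?G X = i_loops G X + (if x \<in> X then 1 else 0)" if "X \<subseteq> V - {v}" for X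
  proof -
    have "{l \<in> loops ?G. fst l \<in> X} = {l \<in> L. fst l \<in> X} \<union> (if x \<in> X then {(x, k)} else {})"
      using that by (auto simp: remove_add_loop_def)
    then show ?thesis using assms(3) by (simp add: i_loops_def)
  qed
  show "rigid_Mlc_circuit ?G"
  proof (rule reduced_circuit[OF assms(1) lsg])
    show "verts ?G = V - {v}" by (simp add: remove_add_loop_def)
  next
    fix X assume X: "X \<subset> V - {v}"
    then show "i_all ?G X \<le> i_all G X \<or> i_all ?G X \<le> i_all G X + 1 \<and> \<not> full X"
      using assms(4)[of X] ie[of X] il[of X] by (auto simp: i_all_def)
  next
    show "i_all ?G (V - {v}) = i_all G (V - {v}) + 1"
      using ie[of "V - {v}"] il[of "V - {v}"] assms(2) by (simp add: i_all_def)
  qed (simp add: ie)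
qed

lemma remove_add_edge_circuit:
  assumes "node v" "x \<in> V - {v}" "y \<in> V - {v}" "x \<noteq> y"
    and "\<And>Y. full Y \<Longrightarrow> {x, y} \<subseteq> Y \<Longrightarrow> \<not> Y \<subset> V - {v}"
    and "\<And>Z. rigid Z \<Longrightarrow> {x, y} \<subseteq> Z \<Longrightarrow> \<not> Z \<subseteq> V - {v}"
  shows "{x, y} \<notin> E" "looped_simple_graph (remove_add_edge v {x, y})"
    "rigid_Mlc_circuit (remove_add_edge v {x, y})"
proof -
  let ?G = "remove_add_edge v {x, y}"
  \<comment> \<open>The ends of an existing edge form a rigid set of two vertices, which the
    hypothesis on rigid sets excludes.\<close>
  show nE: "{x, y} \<notin> E"
  proof
    assume "{x, y} \<in> E"
    then have "nbrs G x \<inter> {y} = {y}" by (auto simp: nbrs_def)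
    then have "i_edges G {x, y} = 1" using i_edges_insert[of x "{y}"] assms(4) by simp
    then have "rigid {x, y}" using assms(2-4) by (simp add: rigid_def)
    then show False using assms(6)[of "{x, y}"] assms(2,3) by auto
  qed
  show lsg: "looped_simple_graph ?G"
    using assms(2-4) edge_subset edge_card loop_vertex
    by (auto simp: looped_simple_graph_def remove_add_edge_def)
  have ie: "i_edges ?G X = i_edges G X + (if {x, y} \<subseteq> X then 1 else 0)" if "X \<subseteq> V - {v}" for X
  proof -
    have "{e \<in> edges ?G. e \<subseteq> X} = {e \<in> E. e \<subseteq> X} \<union> (if {x, y} \<subseteq> X then {{x, y}} else {})"
      using that assms(2,3) by (auto simp: remove_add_edge_def)
    then show ?thesis using nE by (simp add: i_edges_def)
  qed
  have il: "i_loops ?G X = i_loops G X" if "X \<subseteq> V - {v}" for X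
  proof -
    have "{l \<in> loops ?G. fst l \<in> X} = {l \<in> L. fst l \<in> X}" using that by (auto simp: remove_add_edge_def)
    then show ?thesis by (simp add: i_loops_def)
  qed
  show "rigid_Mlc_circuit ?G"
  proof (rule reduced_circuit[OF assms(1) lsg])
    show "verts ?G = V - {v}" by (simp add: remove_add_edge_def)
  next
    fix Z assume Z: "Z \<subseteq> V - {v}"
    then show "i_edges ?G Z \<le> i_edges G Z \<or> i_edges ?G Z \<le> i_edges G Z + 1 \<and> \<not> rigid Z"
      using assms(6)[of Z] ie[of Z] by auto
  next
    fix X assume X: "X \<subset> V - {v}"
    then show "i_all ?G X \<le> i_all G X \<or> i_all ?G X \<le> i_all G X + 1 \<and> \<not> full X"
      using assms(5)[of X] ie[of X] il[of X] by (auto simp: i_all_def)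
  next
    show "i_all ?G (V - {v}) = i_all G (V - {v}) + 1"
      using ie[of "V - {v}"] il[of "V - {v}"] assms(2,3) by (simp add: i_all_def)
  qed
qed

end

section \<open>The edge set of K4 as an explicit list\<close>

lemma pairs_insert:
  assumes "v \<notin> S"
  shows "{e. e \<subseteq> insert v S \<and> card e = 2} = {e. e \<subseteq> S \<and> card e = 2} \<union> (\<lambda>w. {v, w}) ` S"
proof (intro subset_antisym subsetI)
  fix e assume e: "e \<in> {e. e \<subseteq> insert v S \<and> card e = 2}"
  show "e \<in> {e. e \<subseteq> S \<and> card e = 2} \<union> (\<lambda>w. {v, w}) ` S"
  proof (cases "v \<in> e")
    case True
    have "finite e" using e card_gt_0_iff[of e] by simp
    then have "card (e - {v}) = 1" using e True by simp
    then obtain w where "e - {v} = {w}" by (auto simp: card_1_singleton_iff)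
    then have "e = {v, w}" "w \<in> S" using True e by auto
    then show ?thesis by auto
  next
    case False
    then show ?thesis using e by auto
  qed
next
  fix e assume "e \<in> {e. e \<subseteq> S \<and> card e = 2} \<union> (\<lambda>w. {v, w}) ` S"
  then show "e \<in> {e. e \<subseteq> insert v S \<and> card e = 2}"
    using assms by (auto simp: card_insert_if)
qed

lemma pairs_four:
  fixes a :: 'a
  assumes "distinct [a, b, c, d]"
  shows "{e. e \<subseteq> {a, b, c, d} \<and> card e = 2} = {{a, b}, {a, c}, {a, d}, {b, c}, {b, d}, {c, d}}"
proof -
  \<comment> \<open>Repeated use of \<open>pairs_insert\<close> ends at the empty vertex set, where
    \<open>e \<subseteq> {}\<close> is simplified to \<open>e = {}\<close>.\<close>
  have *: "{e :: 'a set. e = {} \<and> card e = 2} = {}" by auto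
  show ?thesis using assms by (simp add: pairs_insert *)
qed

section \<open>Extensions preserve rigid circuits\<close>

text \<open>Builds the copy of K4 needed for the 2-sum on the new vertices and the ends of the edge;
  \<open>K4_extensionE\<close> is the elimination counterpart.\<close>

lemma K4_extensionI:
  assumes "looped_simple_graph G" "{u, v} \<in> edges G" "a \<notin> verts G" "b \<notin> verts G" "a \<noteq> b"
  shows "K4_extension G
    \<lparr>verts = insert a (insert b (verts G)),
     edges = edges G - {{u, v}} \<union> {{a, b}, {a, u}, {a, v}, {b, u}, {b, v}},
     loops = loops G\<rparr>"
proof -
  interpret lsgraph G using assms(1) by unfold_locales
  have uv: "u \<in> V" "v \<in> V" "u \<noteq> v" using edge_subset[OF assms(2)] edge_card[OF assms(2)] by auto
  have d: "distinct [a, b, u, v]" using uv assms(3-5) by auto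
  define K where "K = \<lparr>verts = {a, b, u, v}, edges = {e. e \<subseteq> {a, b, u, v} \<and> card e = 2}, loops = {} :: 'a loop set\<rparr>"
  have "is_K4 K" using d by (simp add: is_K4_def K_def)
  define S where "S = {{a, b}, {a, u}, {a, v}, {b, u}, {b, v}}"
  have "edges K = {{a, b}, {a, u}, {a, v}, {b, u}, {b, v}, {u, v}}"
    using pairs_four[OF d] by (simp add: K_def)
  then have eK: "edges K = insert {u, v} S" by (simp add: S_def insert_commute)
  have "{a, x} \<notin> E" "{b, x} \<notin> E" for x
    using assms(3,4) edge_subset[of "{a, x}"] edge_subset[of "{b, x}"] by auto
  then have ES: "E \<inter> S = {}" by (simp add: S_def)
  then have "{u, v} \<notin> S" using assms(2) by blast
  then have E: "E - {{u, v}} \<union> S = (E \<union> edges K) - {{u, v}}" using eK by auto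
  have "two_sum G K u v \<lparr>verts = insert a (insert b V), edges = E - {{u, v}} \<union> S, loops = L\<rparr>"
    unfolding two_sum_def
  proof (intro conjI)
    show "looped_simple_graph K" by (auto simp: looped_simple_graph_def K_def)
    show "E \<inter> edges K = {{u, v}}" using eK ES assms(2) by simp
    show "V \<inter> verts K = {u, v}" using uv assms(3,4) by (auto simp: K_def)
    show "V \<union> verts K = verts \<lparr>verts = insert a (insert b V), edges = E - {{u, v}} \<union> S, loops = L\<rparr>"
      using uv by (auto simp: K_def)
  qed (use assms(1) E in \<open>simp_all add: K_def\<close>)
  with \<open>is_K4 K\<close> show ?thesis unfolding S_def K4_extension_def by blast
qed

lemma K4_extensionE:
  assumes "K4_extension G H"
  obtains u v a b where "looped_simple_graph G" "{u, v} \<in> edges G" "a \<notin> verts G" "b \<notin> verts G" "a \<noteq> b"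
    "verts H = insert a (insert b (verts G))"
    "edges H = edges G - {{u, v}} \<union> {{a, b}, {a, u}, {a, v}, {b, u}, {b, v}}"
    "loops H = loops G"
proof -
  obtain K u v where K: "is_K4 K" and sum: "two_sum G K u v H"
    using assms by (auto simp: K4_extension_def)
  have uvE: "{u, v} \<in> edges G" "{u, v} \<in> edges K" and lsg: "looped_simple_graph G"
    using sum by (auto simp: two_sum_def)
  have cK: "card (verts K) = 4" using K by (simp add: is_K4_def)
  have "edges K = {e. e \<subseteq> verts K \<and> card e = 2}" using K by (simp add: is_K4_def)
  with uvE(2) have "{u, v} \<in> {e. e \<subseteq> verts K \<and> card e = 2}" by (rule subst[rotated])
  then have uv: "{u, v} \<subseteq> verts K" "card {u, v} = 2" by (rule CollectE, simp)+
  have "card (verts K - {u, v}) = 2" using card_Diff_subset[of "{u, v}" "verts K"] uv cK by simp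
  then obtain a b where ab: "verts K - {u, v} = {a, b}" "a \<noteq> b" by (auto simp: card_2_iff)
  then have vK: "verts K = {a, b, u, v}" using uv(1) by auto
  have "u \<noteq> v" using uv(2) by auto
  then have d: "distinct [a, b, u, v]" using ab by auto
  define S where "S = {{a, b}, {a, u}, {a, v}, {b, u}, {b, v}}"
  have "edges K = {{a, b}, {a, u}, {a, v}, {b, u}, {b, v}, {u, v}}"
    using pairs_four[OF d] K vK by (simp add: is_K4_def)
  then have eK: "edges K = insert {u, v} S" by (simp add: S_def insert_commute)
  have ne: "{u, v} \<notin> S"
    using d by (auto simp: doubleton_eq_iff S_def)
  have "edges H = (edges G \<union> edges K) - {{u, v}}" using sum by (simp add: two_sum_def)
  then have "edges H = edges G - {{u, v}} \<union> S" using eK ne by auto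
  moreover have V: "verts G \<union> verts K = verts H" "verts G \<inter> verts K = {u, v}"
    using sum by (simp_all add: two_sum_def)
  moreover have "a \<notin> verts G" "b \<notin> verts G" using V(2) vK d by auto
  moreover have "verts H = insert a (insert b (verts G))" using V vK by auto
  moreover have "loops H = loops G" using sum K by (simp add: two_sum_def is_K4_def)
  ultimately show thesis using that[of u v a b] lsg uvE(1) ab(2) unfolding S_def by blast
qed

text \<open>
  Common form of the four 1-extensions: the removed edges and loops are \<open>R\<close> and \<open>Q\<close>, the new vertex
  \<open>v\<close> is joined to \<open>A\<close> and receives loops with labels \<open>J\<close>.
\<close>

lemma one_extension_circuit:
  assumes "looped_simple_graph G" "rigid_Mlc_circuit G"
    and H: "H = \<lparr>verts = insert v (verts G), edges = edges G - R \<union> (\<lambda>a. {a, v}) ` A,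
      loops = loops G - Q \<union> Pair v ` J\<rparr>"
    and "v \<notin> verts G" "A \<subseteq> verts G" "finite J" "card A + card J = 3" "card J \<le> 2"
    and cases: "(\<exists>u w. R = {{u, w}} \<and> {u, w} \<in> edges G \<and> u \<in> A \<and> w \<in> A \<and> Q = {}) \<or>
      (\<exists>l. Q = {l} \<and> l \<in> loops G \<and> fst l \<in> A \<and> R = {} \<and> J \<noteq> {})"
  shows "looped_simple_graph H \<and> rigid_Mlc_circuit H"
proof -
  interpret G: circuit G using assms(1,2) by unfold_locales
  have lsg: "looped_simple_graph H"
    using assms(4-6) G.edge_subset G.edge_card G.loop_vertex
    by (auto simp: looped_simple_graph_def H card_insert_if)
  interpret H: lsgraph H using lsg by unfold_locales
  have nb: "nbrs H v = A"
    using assms(4,5) G.edge_subset by (auto simp: nbrs_def H doubleton_eq_iff)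
  have "loops_at H v = Pair v ` J"
    using assms(4) G.loop_vertex by (auto simp: loops_at_def H)
  then have lp: "card (loops_at H v) = card J" by (simp add: card_image inj_on_def)
  have eX: "{e \<in> edges H. e \<subseteq> X} = {e \<in> edges G. e \<subseteq> X} - R"
    and lX: "{l \<in> loops H. fst l \<in> X} = {l \<in> loops G. fst l \<in> X} - Q" if "X \<subseteq> verts G" for X
    using that assms(4) by (auto simp: H)
  have ie: "i_edges H X \<le> i_edges G X" and il: "i_loops H X \<le> i_loops G X" if "X \<subseteq> verts G" for X
    using eX[OF that] lX[OF that] by (auto simp: i_edges_def i_loops_def intro!: card_mono)
  have ia: "i_all H X \<le> i_all G X" if "X \<subseteq> verts G" for X
    using ie[OF that] il[OF that] by (simp add: i_all_def)
  \<comment> \<open>The removed edge or loop has its ends in \<open>A\<close>, so any set containing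
    \<open>A\<close> loses exactly one element. If \<open>card A = 3\<close> then \<open>J\<close>
    is empty, which rules out a removed loop, so the loss is an edge.\<close>
  have A_in: "(card A = 3 \<longrightarrow> i_edges H X + 1 = i_edges G X) \<and> i_all H X + 1 = i_all G X"
    if X: "X \<subseteq> verts G" and AX: "A \<subseteq> X" for X
    using cases
  proof (elim disjE exE conjE)
    fix u w assume *: "R = {{u, w}}" "{u, w} \<in> edges G" "u \<in> A" "w \<in> A" "Q = {}"
    then have "{u, w} \<in> {e \<in> edges G. e \<subseteq> X}" using AX by auto
    then have "i_edges H X + 1 = i_edges G X"
      using card_Suc_Diff1[of "{e \<in> edges G. e \<subseteq> X}" "{u, w}"] eX[OF X] * by (simp add: i_edges_def)
    moreover have "i_loops H X = i_loops G X" using lX[OF X] * by (simp add: i_loops_def)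
    ultimately show ?thesis by (simp add: i_all_def)
  next
    fix l assume *: "Q = {l}" "l \<in> loops G" "fst l \<in> A" "R = {}" "J \<noteq> {}"
    then have "l \<in> {l \<in> loops G. fst l \<in> X}" using AX by auto
    then have "i_loops H X + 1 = i_loops G X"
      using card_Suc_Diff1[of "{l \<in> loops G. fst l \<in> X}" l] lX[OF X] * by (simp add: i_loops_def)
    moreover have "i_edges H X = i_edges G X" using eX[OF X] * by (simp add: i_edges_def)
    moreover have "card J \<noteq> 0" using * assms(6) by simp
    then have "card A \<noteq> 3" using assms(7) by linarith
    ultimately show ?thesis by (simp add: i_all_def)
  qed
  have finA: "finite A" using assms(5) G.finite_sub by blast
  have A_out: "card (A \<inter> X) < card A" if "\<not> A \<subseteq> X" for X
    using that finA by (intro psubset_card_mono) auto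
  have A_le: "card (A \<inter> X) \<le> card A" for X using finA by (intro card_mono) auto
  have cA: "card A \<le> 3" using assms(7) by linarith
  have iH: "i_edges H (insert v X) = i_edges H X + card (A \<inter> X)"
    "i_all H (insert v X) = i_all H X + card (A \<inter> X) + card J" if "v \<notin> X" for X
    using H.i_edges_insert[OF that] H.i_all_insert[OF that] nb lp by simp_all
  have vH: "verts H = insert v (verts G)" by (simp add: H)
  have "rigid_Mlc_circuit H"
    unfolding rigid_Mlc_circuit_def
  proof (intro conjI allI impI; (elim conjE)?)
    \<comment> \<open>One element is removed and three are added: a net gain of two for one new
      vertex.\<close>
    have "i_all H (verts H) = i_all H (verts G) + card A + card J"
      using iH(2)[OF assms(4)] assms(5) by (simp add: vH Int_absorb2)
    moreover have "i_all H (verts G) + 1 = i_all G (verts G)" using A_in[of "verts G"] assms(5) by blast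
    ultimately show "card (edges H) + card (loops H) = 2 * card (verts H) + 1"
      using G.i_all_V_eq assms(4,7) H.i_all_V by (simp add: vH)
  next
    fix X assume X: "X \<subseteq> verts H" "2 \<le> card X"
    show "i_edges H X \<le> 2 * card X - 3"
    proof (cases "v \<in> X")
      case False
      then have "X \<subseteq> verts G" using X by (auto simp: vH)
      then show ?thesis using ie[of X] G.i_edges_le[of X] X by linarith
    next
      case True
      define Y where "Y = X - {v}"
      have Y: "X = insert v Y" "v \<notin> Y" "Y \<subseteq> verts G" using True X by (auto simp: Y_def vH)
      have finY: "finite Y" using Y G.finite_sub by blast
      have cX: "card X = card Y + 1" using Y finY by simp
      have i: "i_edges H X = i_edges H Y + card (A \<inter> Y)" using iH(1)[OF Y(2)] Y(1) by simp
      consider "card Y = 1" | "2 \<le> card Y" using cX X by linarith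
      then show ?thesis
      proof cases
        case 1
        then obtain y where "Y = {y}" by (auto simp: card_1_singleton_iff)
        then have "i_edges H Y = 0" by simp
        moreover have "card (A \<inter> Y) \<le> card Y" using finY by (intro card_mono) auto
        ultimately show ?thesis using i cX 1 by simp
      next
        case 2
        then have *: "i_edges G Y + 3 \<le> 2 * card Y" using Y by (intro G.i_edges_le) auto
        show ?thesis
        \<comment> \<open>Three new edges occur only if \<open>A\<close> lies in \<open>Y\<close>,
          and then the lost edge compensates for one of them.\<close>
        proof (cases "A \<subseteq> Y \<and> card A = 3")
          case True
          then have "i_edges H Y + 1 = i_edges G Y" using A_in[OF Y(3)] by blast
          then show ?thesis using i cX * A_le[of Y] cA by linarith
        next
          case False
          then have "card (A \<inter> Y) \<le> 2" using A_le[of Y] A_out[of Y] cA by linarith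
          then show ?thesis using i cX * ie[OF Y(3)] by linarith
        qed
      qed
    qed
  next
    fix X assume X: "X \<subset> verts H"
    show "i_all H X \<le> 2 * card X"
    proof (cases "v \<in> X")
      case False
      then have XG: "X \<subseteq> verts G" using X by (auto simp: vH)
      show ?thesis
      \<comment> \<open>The old vertex set is now a proper subset and must give up its surplus 1,
        which is the removed element.\<close>
      proof (cases "X = verts G")
        case True
        then have "i_all H X + 1 = i_all G X" using A_in[of X] assms(5) by blast
        then show ?thesis using G.i_all_V_eq True by simp
      next
        case False
        then show ?thesis using ia[OF XG] G.i_all_le[of X] XG by fastforce
      qed
    next
      case True
      define Y where "Y = X - {v}"
      have Y: "X = insert v Y" "v \<notin> Y" "Y \<subset> verts G" using True X by (auto simp: Y_def vH)
      have YG: "Y \<subseteq> verts G" using Y by auto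
      have cX: "card X = card Y + 1" using Y G.finite_sub[OF YG] by simp
      have i: "i_all H X = i_all H Y + card (A \<inter> Y) + card J" using iH(2)[OF Y(2)] Y(1) by simp
      have *: "i_all G Y \<le> 2 * card Y" using Y(3) by (rule G.i_all_le)
      show ?thesis
      proof (cases "A \<subseteq> Y")
        case True
        then have "i_all H Y + 1 = i_all G Y" using A_in[OF YG] by blast
        then show ?thesis using i cX * A_le[of Y] assms(7) by linarith
      next
        case False
        then show ?thesis using A_out[of Y] i cX * ia[OF YG] assms(7) by linarith
      qed
    qed
  qed
  with lsg show ?thesis by blast
qed

lemma one_extension_preserves:
  assumes "one_extension G H" "looped_simple_graph G" "rigid_Mlc_circuit G"
  shows "looped_simple_graph H \<and> rigid_Mlc_circuit H"
  using assms(1)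
proof cases
  case (edge_edge u w v x)
  interpret lsgraph G using assms(2) by unfold_locales
  have "{u, w} \<subseteq> V" using edge_subset edge_edge by blast
  then show ?thesis
    using edge_edge
    by (intro one_extension_circuit[OF assms(2,3), where v = v and R = "{{u, w}}" and A = "{u, w, x}" and Q = "{}" and J = "{}"])
      (auto simp: insert_commute)
next
  case (edge_loop u w v i)
  interpret lsgraph G using assms(2) by unfold_locales
  have "{u, w} \<subseteq> V" using edge_subset edge_loop by blast
  then show ?thesis
    using edge_loop
    by (intro one_extension_circuit[OF assms(2,3), where v = v and R = "{{u, w}}" and A = "{u, w}" and Q = "{}" and J = "{i}"])
      auto
next
  case (loop_edge l u v w i)
  interpret lsgraph G using assms(2) by unfold_locales
  have "u \<in> V" using loop_vertex loop_edge by blast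
  then show ?thesis
    using loop_edge
    by (intro one_extension_circuit[OF assms(2,3), where v = v and R = "{}" and A = "{u, w}" and Q = "{l}" and J = "{i}"])
      auto
next
  case (loop_loop l u v i j)
  interpret lsgraph G using assms(2) by unfold_locales
  have "u \<in> V" using loop_vertex loop_loop by blast
  then show ?thesis
    using loop_loop
    by (intro one_extension_circuit[OF assms(2,3), where v = v and R = "{}" and A = "{u}" and Q = "{l}" and J = "{i, j}"])
      auto
qed

text \<open>A set of \<open>H\<close> is determined by its trace \<open>Y\<close> on the old
  vertices and by which of \<open>a\<close>, \<open>b\<close> it contains, so every bound reduces to
  \<open>card Y\<close>, the counts of \<open>Y\<close> and the number \<open>t Y\<close> of ends of
  the deleted edge in \<open>Y\<close>.\<close>

lemma K4_extension_preserves: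
  assumes "K4_extension G H" "rigid_Mlc_circuit G"
  shows "looped_simple_graph H \<and> rigid_Mlc_circuit H"
proof -
  obtain u v a b where G: "looped_simple_graph G" and uvE: "{u, v} \<in> edges G"
    and ab: "a \<notin> verts G" "b \<notin> verts G" "a \<noteq> b"
    and vH: "verts H = insert a (insert b (verts G))"
    and eH: "edges H = edges G - {{u, v}} \<union> {{a, b}, {a, u}, {a, v}, {b, u}, {b, v}}"
    and lH: "loops H = loops G"
    using K4_extensionE[OF assms(1)] .
  interpret G: circuit G using G assms(2) by unfold_locales
  have uv: "u \<in> verts G" "v \<in> verts G" "u \<noteq> v"
    using G.edge_subset[OF uvE] G.edge_card[OF uvE] by auto
  have ne: "a \<noteq> u" "a \<noteq> v" "b \<noteq> u" "b \<noteq> v" using uv ab by auto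
  have lsg: "looped_simple_graph H"
    using uv ab ne G.edge_subset G.edge_card G.loop_vertex
    by (auto simp: looped_simple_graph_def vH eH lH card_insert_if)
  interpret H: lsgraph H using lsg by unfold_locales
  have notE: "{a, x} \<notin> edges G" "{b, x} \<notin> edges G" for x
    using ab G.edge_subset[of "{a, x}"] G.edge_subset[of "{b, x}"] by auto
  have nb: "nbrs H a = {b, u, v}" "nbrs H b = {a, u, v}"
    using ab(3) ne uv(3) by (auto simp: nbrs_def eH notE doubleton_eq_iff)
  have lp: "loops_at H a = {}" "loops_at H b = {}"
    using ab G.loop_vertex by (auto simp: loops_at_def lH)
  define t where "t Y = card ({u, v} \<inter> Y)" for Y
  have t2: "t Y \<le> 2" for Y
    using card_mono[of "{u, v}" "{u, v} \<inter> Y"] uv(3) by (simp add: t_def)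
  have tY: "t Y \<le> card Y" if "Y \<subseteq> verts G" for Y
    unfolding t_def using G.finite_sub[OF that] by (intro card_mono) auto
  have tuv: "{u, v} \<subseteq> Y \<longleftrightarrow> t Y = 2" for Y
    using uv(3) by (auto simp: t_def Int_insert_left split: if_splits)
  have ie: "i_edges H Y + (if t Y = 2 then 1 else 0) = i_edges G Y" if "Y \<subseteq> verts G" for Y
  proof -
    have eq: "{e \<in> edges H. e \<subseteq> Y} = {e \<in> edges G. e \<subseteq> Y} - {{u, v}}"
      using that ab by (auto simp: eH)
    show ?thesis
    proof (cases "t Y = 2")
      case True
      then have "{u, v} \<in> {e \<in> edges G. e \<subseteq> Y}" using uvE by (simp add: tuv[symmetric])
      then have "Suc (card ({e \<in> edges G. e \<subseteq> Y} - {{u, v}})) = card {e \<in> edges G. e \<subseteq> Y}"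
        by (intro card_Suc_Diff1) simp_all
      then show ?thesis using True by (simp add: i_edges_def eq)
    next
      case False
      then have "{u, v} \<notin> {e \<in> edges G. e \<subseteq> Y}" by (simp add: tuv[symmetric])
      then have "{e \<in> edges G. e \<subseteq> Y} - {{u, v}} = {e \<in> edges G. e \<subseteq> Y}" by blast
      then show ?thesis using False by (simp add: i_edges_def eq)
    qed
  qed
  have il: "i_loops H Y = i_loops G Y" for Y by (simp add: i_loops_def lH)
  have ia: "i_all H Y + (if t Y = 2 then 1 else 0) = i_all G Y" if "Y \<subseteq> verts G" for Y
    using ie[OF that] il by (simp add: i_all_def)
  have in_a: "i_edges H (insert a Y) = i_edges H Y + t Y" "i_loops H (insert a Y) = i_loops H Y"
    and in_b: "i_edges H (insert b Y) = i_edges H Y + t Y" "i_loops H (insert b Y) = i_loops H Y"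
    and in_ab: "i_edges H (insert a (insert b Y)) = i_edges H Y + 2 * t Y + 1"
      "i_loops H (insert a (insert b Y)) = i_loops H Y"
    if "Y \<subseteq> verts G" for Y
  proof -
    have n: "a \<notin> Y" "b \<notin> Y" "a \<notin> insert b Y" using that ab by auto
    have *: "{b, u, v} \<inter> Y = {u, v} \<inter> Y" "{a, u, v} \<inter> Y = {u, v} \<inter> Y"
      "{b, u, v} \<inter> insert b Y = insert b ({u, v} \<inter> Y)"
      using n ne by auto
    have **: "card (insert b ({u, v} \<inter> Y)) = t Y + 1" using n by (simp add: t_def)
    show a: "i_edges H (insert a Y) = i_edges H Y + t Y" and b: "i_edges H (insert b Y) = i_edges H Y + t Y"
      using H.i_edges_insert[OF n(1)] H.i_edges_insert[OF n(2)] * by (simp_all add: nb t_def)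
    show "i_edges H (insert a (insert b Y)) = i_edges H Y + 2 * t Y + 1"
      using H.i_edges_insert[OF n(3)] b ** unfolding nb * by simp
    show "i_loops H (insert a Y) = i_loops H Y" "i_loops H (insert b Y) = i_loops H Y"
      "i_loops H (insert a (insert b Y)) = i_loops H Y"
      using H.i_loops_insert[OF n(1)] H.i_loops_insert[OF n(2)] H.i_loops_insert[OF n(3)] lp by simp_all
  qed
  \<comment> \<open>These are the edge bounds for \<open>insert a Y\<close> (equally
    \<open>insert b Y\<close>) and for \<open>insert a (insert b Y)\<close>, rewritten as conditions
    on \<open>Y\<close>.\<close>
  have e1: "i_edges H Y + t Y + 1 \<le> 2 * card Y" "i_edges H Y + 2 * t Y \<le> 2 * card Y"
    if Y: "Y \<subseteq> verts G" "1 \<le> card Y" for Y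
  proof -
    have "i_edges H Y + t Y + 1 \<le> 2 * card Y \<and> i_edges H Y + 2 * t Y \<le> 2 * card Y"
    proof (cases "card Y = 1")
      case True
      then obtain y where "Y = {y}" by (auto simp: card_1_singleton_iff)
      then have "i_edges H Y = 0" by simp
      then show ?thesis using tY[OF Y(1)] True by linarith
    next
      case False
      then have "i_edges G Y + 3 \<le> 2 * card Y" using Y by (intro G.i_edges_le) linarith+
      then show ?thesis using ie[OF Y(1)] t2[of Y] by (cases "t Y = 2") simp_all
    qed
    then show "i_edges H Y + t Y + 1 \<le> 2 * card Y" "i_edges H Y + 2 * t Y \<le> 2 * card Y" by auto
  qed
  have split: "\<exists>Y\<subseteq>verts G. X = Y \<or> (X = insert a Y \<or> X = insert b Y) \<and> card X = card Y + 1
      \<or> X = insert a (insert b Y) \<and> card X = card Y + 2" if X: "X \<subseteq> verts H" for X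
  proof -
    let ?Y = "X - {a, b}"
    have sub: "?Y \<subseteq> verts G" using X vH by auto
    have fin: "finite ?Y" using G.finite_sub[OF sub] .
    have "X = ?Y \<or> X = insert a ?Y \<or> X = insert b ?Y \<or> X = insert a (insert b ?Y)" by auto
    moreover have "card (insert a ?Y) = card ?Y + 1" "card (insert b ?Y) = card ?Y + 1"
      "card (insert a (insert b ?Y)) = card ?Y + 2"
      using fin ab(3) by simp_all
    ultimately show ?thesis using sub by metis
  qed
  have "rigid_Mlc_circuit H"
    unfolding rigid_Mlc_circuit_def
  proof (intro conjI allI impI; (elim conjE)?)
    \<comment> \<open>The old vertex set loses the edge \<open>{u, v}\<close> and the new vertices
      bring five edges: a gain of 4 for two vertices.\<close>
    have "t (verts G) = 2" using uv by (simp add: tuv[symmetric])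
    then have "i_all H (verts H) = i_all G (verts G) + 4"
      using in_ab[of "verts G"] ia[of "verts G"] by (simp add: vH i_all_def)
    moreover have "card (verts H) = card (verts G) + 2" using ab by (simp add: vH)
    ultimately show "card (edges H) + card (loops H) = 2 * card (verts H) + 1"
      using G.i_all_V_eq H.i_all_V by simp
  next
    fix X assume X: "X \<subseteq> verts H" "2 \<le> card X"
    obtain Y where Y: "Y \<subseteq> verts G" and cs: "X = Y \<or> (X = insert a Y \<or> X = insert b Y) \<and> card X = card Y + 1
      \<or> X = insert a (insert b Y) \<and> card X = card Y + 2" using split[OF X(1)] by blast
    have "i_edges H X + 3 \<le> 2 * card X"
      using cs
    proof (elim disjE conjE)
      assume "X = Y"
      then have "i_edges G Y + 3 \<le> 2 * card Y" using X(2) Y by (intro G.i_edges_le) auto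
      then show ?thesis using ie[OF Y] \<open>X = Y\<close> by (simp split: if_splits)
    next
      assume "X = insert a Y" "card X = card Y + 1"
      then show ?thesis using in_a(1)[OF Y] e1(1)[OF Y] X(2) by simp
    next
      assume "X = insert b Y" "card X = card Y + 1"
      then show ?thesis using in_b(1)[OF Y] e1(1)[OF Y] X(2) by simp
    next
      assume *: "X = insert a (insert b Y)" "card X = card Y + 2"
      show ?thesis
      proof (cases "card Y = 0")
        case True
        then have "Y = {}" using G.finite_sub[OF Y] by simp
        then show ?thesis using * in_ab(1)[OF Y] by (simp add: t_def)
      next
        case False
        then show ?thesis using * in_ab(1)[OF Y] e1(2)[OF Y] by simp
      qed
    qed
    then show "i_edges H X \<le> 2 * card X - 3" by linarith
  next
    fix X assume X: "X \<subset> verts H"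
    then have sub: "X \<subseteq> verts H" by auto
    obtain Y where Y: "Y \<subseteq> verts G" and cs: "X = Y \<or> (X = insert a Y \<or> X = insert b Y) \<and> card X = card Y + 1
      \<or> X = insert a (insert b Y) \<and> card X = card Y + 2" using split[OF sub] by blast
    \<comment> \<open>For \<open>Y = verts G\<close> the loss of \<open>{u, v}\<close> cancels the
      surplus 1 of \<open>G\<close>.\<close>
    have le: "i_all H Y \<le> 2 * card Y"
    proof (cases "Y = verts G")
      case True
      then have "t Y = 2" using uv by (simp add: tuv[symmetric])
      then show ?thesis using ia[OF Y] G.i_all_V_eq True by simp
    next
      case False
      then have "i_all G Y \<le> 2 * card Y" using Y by (intro G.i_all_le) auto
      then show ?thesis using ia[OF Y] by linarith
    qed
    show "i_all H X \<le> 2 * card X"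
      using cs
    proof (elim disjE conjE)
      assume "X = Y"
      then show ?thesis using le by simp
    next
      assume "X = insert a Y" "card X = card Y + 1"
      then show ?thesis using in_a[OF Y] le t2[of Y] by (simp add: i_all_def)
    next
      assume "X = insert b Y" "card X = card Y + 1"
      then show ?thesis using in_b[OF Y] le t2[of Y] by (simp add: i_all_def)
    next
      assume *: "X = insert a (insert b Y)" "card X = card Y + 2"
      \<comment> \<open>As \<open>X\<close> is proper and contains both new vertices, it omits an
        old one, so \<open>Y\<close> has no surplus in \<open>G\<close>.\<close>
      then have "Y \<noteq> verts G" using X vH by auto
      then have "i_all G Y \<le> 2 * card Y" using Y by (intro G.i_all_le) auto
      then have "i_all H Y + 2 * t Y \<le> 2 * card Y + 3"
        using ia[OF Y] t2[of Y] by (cases "t Y = 2") simp_all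
      then show ?thesis using * in_ab[OF Y] by (simp add: i_all_def)
    qed
  qed
  with lsg show ?thesis by blast
qed

text \<open>\<open>looped_simple_graph\<close> is carried through the induction because
  \<open>one_extension_preserves\<close> assumes it.\<close>

lemma constructible_circuit:
  "constructible G \<Longrightarrow> looped_simple_graph G \<and> rigid_Mlc_circuit G"
proof (induction rule: constructible.induct)
  case (K1_3 G)
  then obtain v where G: "verts G = {v}" "edges G = {}" "card (loops G) = 3" "\<forall>l\<in>loops G. fst l = v"
    by (auto simp: is_K1_3_def)
  \<comment> \<open>Infinite sets have \<open>card\<close> 0, so cardinality 3 forces
    finiteness.\<close>
  then have "finite (loops G)" using card_gt_0_iff[of "loops G"] by simp
  moreover have "i_all G {} = 0" by (simp add: i_all_def i_edges_def i_loops_def G(2))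
  moreover have "X \<subset> {v} \<longleftrightarrow> X = {}" for X by auto
  moreover have "i_edges G X = 0" for X by (simp add: i_edges_def G(2))
  ultimately show ?case using G by (simp add: looped_simple_graph_def rigid_Mlc_circuit_def)
next
  case (one_ext G H)
  then show ?case using one_extension_preserves by blast
next
  case (K4_ext G H)
  then show ?case using K4_extension_preserves by blast
qed

section \<open>Reducing a rigid circuit\<close>

context circuit
begin

text \<open>A node with a neighbour and a loop carries one or two loops; accordingly
  \<open>G\<close> arises by \<open>loop_edge\<close> or \<open>loop_loop\<close> from the graph
  with a fresh loop at \<open>x\<close>.\<close>

lemma loop_reduction:
  assumes "node v" "x \<in> nbrs G v" "loops_at G v \<noteq> {}"
    and "\<And>Y. full Y \<Longrightarrow> x \<in> Y \<Longrightarrow> \<not> Y \<subset> V - {v}"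
  obtains G' where "looped_simple_graph G'" "rigid_Mlc_circuit G'" "verts G' = V - {v}" "one_extension G' G"
proof -
  obtain k where k: "(x, k) \<notin> L" using fresh_loop .
  let ?G = "remove_add_loop v (x, k)"
  have v: "v \<in> V" using assms(1) by (simp add: node_def)
  have x: "x \<in> V - {v}" using assms(2) nbrs_subset[of v] not_nbr_self[of v] by auto
  have V: "insert v (V - {v}) = V" using v by auto
  have L: "insert (x, k) {l \<in> L. fst l \<noteq> v} - {(x, k)} \<union> loops_at G v = L"
    using k loops_split[of v] by auto
  have E: "{e \<in> E. v \<notin> e} \<union> (\<lambda>a. {a, v}) ` nbrs G v = E" using edges_split[of v] by simp
  have "card (nbrs G v) + card (loops_at G v) = 3" using assms(1) by (simp add: node_def deg_def)
  moreover have "card (nbrs G v) \<noteq> 0" using assms(2) by auto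
  moreover have "card (loops_at G v) \<noteq> 0" using assms(3) by simp
  ultimately consider "card (nbrs G v) = 2" "card (loops_at G v) = 1" | "card (nbrs G v) = 1" "card (loops_at G v) = 2"
    by linarith
  then have "one_extension ?G G"
  proof cases
    case 1
    then have "card (nbrs G v - {x}) = 1" using assms(2) by simp
    then obtain w where "nbrs G v - {x} = {w}" by (auto simp: card_1_singleton_iff)
    then have w: "nbrs G v = {x, w}" "w \<noteq> x" using assms(2) by auto
    obtain l where l: "loops_at G v = {l}" using 1(2) by (auto simp: card_1_singleton_iff)
    then have "fst l = v" by (auto simp: loops_at_def)
    with l obtain i where i: "loops_at G v = {(v, i)}" by (cases l) auto
    have "w \<in> V - {v}" using w nbrs_subset[of v] not_nbr_self[of v] by auto
    then have "one_extension ?G \<lparr>verts = insert v (verts ?G), edges = edges ?G \<union> {{x, v}, {w, v}},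
        loops = (loops ?G - {(x, k)}) \<union> {(v, i)}\<rparr>"
      using w by (intro one_extension.loop_edge) (auto simp: remove_add_loop_def)
    moreover have "\<dots> = G"
      using V E L w i by (intro lgraph.equality) (simp_all add: remove_add_loop_def)
    ultimately show ?thesis by simp
  next
    case 2
    then have w: "nbrs G v = {x}" using assms(2) by (auto simp: card_1_singleton_iff)
    obtain l m where l: "loops_at G v = {l, m}" "l \<noteq> m" using 2(2) by (auto simp: card_2_iff)
    then have "fst l = v" "fst m = v" by (auto simp: loops_at_def)
    with l obtain i j where i: "loops_at G v = {(v, i), (v, j)}" "i \<noteq> j" by (cases l; cases m) auto
    have "one_extension ?G \<lparr>verts = insert v (verts ?G), edges = edges ?G \<union> {{x, v}},
        loops = (loops ?G - {(x, k)}) \<union> {(v, i), (v, j)}\<rparr>"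
      using i by (intro one_extension.loop_loop) (auto simp: remove_add_loop_def)
    moreover have "\<dots> = G"
      using V E L w i by (intro lgraph.equality) (simp_all add: remove_add_loop_def)
    ultimately show ?thesis by simp
  qed
  then show thesis
    using that[of ?G] remove_add_loop_circuit[OF assms(1) x k assms(4)] by (simp add: remove_add_loop_def)
qed

lemma edge_reduction:
  assumes "node v" "nbrs G v = {x, y, z}" "card (nbrs G v) = 3"
    and "\<And>Y. full Y \<Longrightarrow> {x, y} \<subseteq> Y \<Longrightarrow> \<not> Y \<subset> V - {v}"
    and "\<And>Z. rigid Z \<Longrightarrow> {x, y} \<subseteq> Z \<Longrightarrow> \<not> Z \<subseteq> V - {v}"
  obtains G' where "looped_simple_graph G'" "rigid_Mlc_circuit G'" "verts G' = V - {v}" "one_extension G' G"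
proof -
  let ?G = "remove_add_edge v {x, y}"
  have v: "v \<in> V" using assms(1) by (simp add: node_def)
  have d: "x \<noteq> y" "x \<noteq> z" "y \<noteq> z" using assms(2,3) by (auto simp: card_insert_if split: if_splits)
  have xyz: "x \<in> V - {v}" "y \<in> V - {v}" "z \<in> V - {v}"
    using assms(2) nbrs_subset[of v] not_nbr_self[of v] by auto
  note red = remove_add_edge_circuit[OF assms(1) xyz(1,2) d(1) assms(4,5)]
  have "deg G v = 3" using assms(1) by (simp add: node_def)
  then have "loops_at G v = {}" using assms(3) by (simp add: deg_def)
  then have L: "{l \<in> L. fst l \<noteq> v} = L" using loops_split[of v] by simp
  have E: "{e \<in> E. v \<notin> e} \<union> {{x, v}, {y, v}, {z, v}} = E" using edges_split[of v] assms(2) by simp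
  have E': "insert {x, y} {e \<in> E. v \<notin> e} - {{x, y}} = {e \<in> E. v \<notin> e}" using red(1) by simp
  have V: "insert v (V - {v}) = V" using v by auto
  have "one_extension ?G \<lparr>verts = insert v (verts ?G), edges = edges ?G - {{x, y}} \<union> {{x, v}, {y, v}, {v, z}},
      loops = loops ?G\<rparr>"
    using d xyz by (intro one_extension.edge_edge) (auto simp: remove_add_edge_def)
  moreover have "\<dots> = G"
    using V E E' L by (intro lgraph.equality) (simp_all add: remove_add_edge_def insert_commute[of v z])
  ultimately have "one_extension ?G G" by simp
  then show thesis using that[of ?G] red(2,3) by (simp add: remove_add_edge_def)
qed

text \<open>To a set containing \<open>x\<close> and \<open>y\<close> the vertices \<open>v\<close>,
  \<open>w\<close> add five edges but only 4 to the bound. The bounds of \<open>G\<close> on the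
  enlarged set therefore leave room for the edge \<open>{x, y}\<close>.\<close>

lemma K4_reduction:
  assumes "node v" "node w" "nbrs G v = {w, x, y}" "nbrs G w = {v, x, y}" "x \<noteq> y"
    and "loops_at G v = {}" "loops_at G w = {}"
  obtains G' where "looped_simple_graph G'" "rigid_Mlc_circuit G'" "verts G' = V - {v, w}" "K4_extension G' G"
proof -
  define U where "U = V - {v, w}"
  define G' where "G' = \<lparr>verts = U, edges = insert {x, y} {e \<in> E. v \<notin> e \<and> w \<notin> e}, loops = L\<rparr>"
  have vw: "v \<in> V" "w \<in> V" using assms(1,2) by (simp_all add: node_def)
  have ne: "v \<noteq> w" using assms(3) not_nbr_self[of v] by auto
  have xy: "x \<in> U" "y \<in> U"
    using nbrs_subset[of v] not_nbr_self[of v] not_nbr_self[of w] assms(3,4) by (auto simp: U_def)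
  have UV: "insert v (insert w U) = V" "v \<notin> U" "w \<notin> U" "U \<subseteq> V" using vw by (auto simp: U_def)
  have fin: "finite Y" if "Y \<subseteq> U" for Y using that UV(4) finite_sub by blast
  have ins: "i_edges G (insert v (insert w Y)) = i_edges G Y + 5"
    "i_all G (insert v (insert w Y)) = i_all G Y + 5"
    "card (insert v (insert w Y)) = card Y + 2" if "Y \<subseteq> U" "{x, y} \<subseteq> Y" for Y
  proof -
    have n: "v \<notin> insert w Y" "w \<notin> Y" using that UV ne by auto
    have "{w, x, y} \<inter> insert w Y = {w, x, y}" "{v, x, y} \<inter> Y = {x, y}" using that UV by auto
    moreover have "w \<noteq> x" "w \<noteq> y" using xy UV(3) by auto
    then have "card {w, x, y} = 3" "card {x, y} = 2" using assms(5) by simp_all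
    ultimately show "i_edges G (insert v (insert w Y)) = i_edges G Y + 5"
      "i_all G (insert v (insert w Y)) = i_all G Y + 5"
      using i_edges_insert[OF n(1)] i_edges_insert[OF n(2)] i_all_insert[OF n(1)] i_all_insert[OF n(2)]
        assms(3,4,6,7) by simp_all
    show "card (insert v (insert w Y)) = card Y + 2" using n fin[OF that(1)] by simp
  qed
  have le: "i_edges G Y + 4 \<le> 2 * card Y" if "Y \<subseteq> U" "{x, y} \<subseteq> Y" for Y
  proof -
    have "insert v (insert w Y) \<subseteq> V" using that vw UV by auto
    then have "i_edges G (insert v (insert w Y)) + 3 \<le> 2 * card (insert v (insert w Y))"
      using ins(3)[OF that] by (intro i_edges_le) auto
    then show ?thesis using ins[OF that] by simp
  qed
  \<comment> \<open>For \<open>Y = {x, y}\<close> the sharpened bound \<open>le\<close> leaves room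
    for no edge at all.\<close>
  have nE: "{x, y} \<notin> E"
  proof
    assume "{x, y} \<in> E"
    then have "nbrs G x \<inter> {y} = {y}" by (auto simp: nbrs_def)
    then have "i_edges G {x, y} = 1" using i_edges_insert[of x "{y}"] assms(5) by simp
    then show False using le[of "{x, y}"] xy assms(5) by simp
  qed
  have lV: "fst l \<in> U" if "l \<in> L" for l
  proof -
    have "l \<notin> loops_at G v" "l \<notin> loops_at G w" using assms(6,7) by simp_all
    then show ?thesis using that loop_vertex[OF that] by (simp add: U_def loops_at_def)
  qed
  have lsg: "looped_simple_graph G'"
    using xy assms(5) edge_subset edge_card lV fin
    by (auto simp: looped_simple_graph_def G'_def U_def)
  interpret G': lsgraph G' using lsg by unfold_locales
  have ie: "i_edges G' Y = i_edges G Y + (if {x, y} \<subseteq> Y then 1 else 0)" if "Y \<subseteq> U" for Y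
  proof -
    have "{e \<in> edges G'. e \<subseteq> Y} = {e \<in> E. e \<subseteq> Y} \<union> (if {x, y} \<subseteq> Y then {{x, y}} else {})"
      using that UV by (auto simp: G'_def)
    then show ?thesis using nE by (simp add: i_edges_def)
  qed
  have il: "i_loops G' Y = i_loops G Y" for Y by (simp add: i_loops_def G'_def)
  have vG': "verts G' = U" by (simp add: G'_def)
  have "rigid_Mlc_circuit G'"
    unfolding rigid_Mlc_circuit_def vG'
  proof (intro conjI allI impI; (elim conjE)?)
    \<comment> \<open>Five edges are deleted and one is inserted: a loss of 4 for two
      vertices.\<close>
    have "i_all G' U = i_all G U + 1" using ie[of U] il xy by (simp add: i_all_def)
    then show "card (edges G') + card (loops G') = 2 * card U + 1"
      using ins[of U] xy UV(1) i_all_V_eq G'.i_all_V vG' by simp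
  next
    fix Z assume Z: "Z \<subseteq> U" "2 \<le> card Z"
    then have "i_edges G Z + 3 \<le> 2 * card Z" using UV(4) by (intro i_edges_le) auto
    then show "i_edges G' Z \<le> 2 * card Z - 3" using le[of Z] ie[of Z] Z(1) by auto
  next
    fix X assume X: "X \<subset> U"
    show "i_all G' X \<le> 2 * card X"
    proof (cases "{x, y} \<subseteq> X")
      case True
      have "insert v (insert w X) \<subset> V" using X UV by auto
      then have "i_all G (insert v (insert w X)) \<le> 2 * card (insert v (insert w X))" by (rule i_all_le)
      then show ?thesis using ins[of X] X True ie[of X] il[of X] by (simp add: i_all_def)
    next
      case False
      have "i_all G X \<le> 2 * card X" using X UV by (intro i_all_le) auto
      moreover have "i_edges G' X = i_edges G X" using False ie[of X] X by auto
      ultimately show ?thesis using il[of X] by (simp add: i_all_def)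
    qed
  qed
  moreover have "K4_extension G' G"
  proof -
    let ?S = "{{v, w}, {v, x}, {v, y}, {w, x}, {w, y}}"
    have "K4_extension G' \<lparr>verts = insert v (insert w (verts G')),
        edges = edges G' - {{x, y}} \<union> ?S, loops = loops G'\<rparr>"
      using lsg ne UV by (intro K4_extensionI) (simp_all add: G'_def)
    moreover have "edges G' - {{x, y}} \<union> ?S = E"
    proof -
      have "E = {e \<in> E. v \<notin> e} \<union> {{w, v}, {x, v}, {y, v}}" using edges_split[of v] assms(3) by simp
      then have Ev: "E = {e \<in> E. v \<notin> e} \<union> {{v, w}, {v, x}, {v, y}}" by (simp add: insert_commute)
      have "E = {e \<in> E. w \<notin> e} \<union> {{v, w}, {x, w}, {y, w}}" using edges_split[of w] assms(4) by simp
      then have Ew: "E = {e \<in> E. w \<notin> e} \<union> {{v, w}, {w, x}, {w, y}}" by (simp add: insert_commute)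
      have "{e \<in> E. v \<notin> e \<and> w \<notin> e} \<union> ?S = E" (is "?A = E")
      proof
        show "?A \<subseteq> E" using equalityD2[OF Ev] equalityD2[OF Ew] by simp
        show "E \<subseteq> ?A"
        proof
          fix e assume "e \<in> E"
          then have "e \<in> {e \<in> E. v \<notin> e} \<union> {{v, w}, {v, x}, {v, y}}" "e \<in> {e \<in> E. w \<notin> e} \<union> {{v, w}, {w, x}, {w, y}}"
            using subsetD[OF equalityD1[OF Ev]] subsetD[OF equalityD1[OF Ew]] by blast+
          with \<open>e \<in> E\<close> show "e \<in> ?A" by auto
        qed
      qed
      moreover have "edges G' - {{x, y}} = {e \<in> E. v \<notin> e \<and> w \<notin> e}" using nE by (simp add: G'_def)
      ultimately show ?thesis by simp
    qed
    moreover have "insert v (insert w (verts G')) = V" "loops G' = L" using UV by (simp_all add: G'_def)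
    ultimately have "K4_extension G' \<lparr>verts = V, edges = E, loops = L\<rparr>" by simp
    moreover have "\<lparr>verts = V, edges = E, loops = L\<rparr> = G" by simp
    ultimately show ?thesis by (simp only:)
  qed
  ultimately show thesis using that[of G'] lsg vG' by (simp add: U_def)
qed

lemma reduction:
  assumes "2 \<le> card V"
  obtains G' where "looped_simple_graph G'" "rigid_Mlc_circuit G'" "card (verts G') < card V"
    "one_extension G' G \<or> K4_extension G' G"
proof -
  have smaller: "card (V - {v}) < card V" "card (V - {v, w}) < card V" if "node v" for v w
  proof -
    have "V - {v} \<subset> V" "V - {v, w} \<subset> V" using that by (auto simp: node_def)
    then show "card (V - {v}) < card V" "card (V - {v, w}) < card V"
      using psubset_card_mono[OF finite_V] by auto
  qed
  show thesis
  proof (cases "\<exists>c\<in>V. \<not> node c")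
    case True
    then obtain c where c: "c \<in> V" "\<not> node c" by blast
    then show thesis
    proof (cases rule: reduction_cases)
      case (loop v x y)
      have "x \<in> nbrs G v" "loops_at G v \<noteq> {}" using loop by auto
      then obtain G' where "looped_simple_graph G'" "rigid_Mlc_circuit G'" "verts G' = V - {v}" "one_extension G' G"
        using loop_reduction[OF loop(1) _ _ loop(5)] by blast
      then show thesis using that[of G'] smaller[OF loop(1)] by simp
    next
      case (edge v x y z)
      then obtain G' where "looped_simple_graph G'" "rigid_Mlc_circuit G'" "verts G' = V - {v}" "one_extension G' G"
        using edge_reduction[OF edge] by blast
      then show thesis using that[of G'] smaller[OF edge(1)] by simp
    next
      case (K4 v w x y)
      then obtain G' where "looped_simple_graph G'" "rigid_Mlc_circuit G'" "verts G' = V - {v, w}" "K4_extension G' G"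
        using K4_reduction[OF K4] by blast
      then show thesis using that[of G'] smaller[OF K4(1)] by simp
    qed
  next
    case False
    then have nodes: "node w" if "w \<in> V" for w using that by blast
    have "V \<noteq> {}" using assms by auto
    then obtain v where v: "v \<in> V" and leaf: "card (nbrs G v \<inter> V) \<le> 1"
      using nodes_leaf[OF subset_refl _ nodes] by blast
    have le1: "card (nbrs G v) \<le> 1" using leaf nbrs_subset[of v] by (simp add: Int_absorb2)
    have d: "card (nbrs G v) + card (loops_at G v) = 3" using nodes[OF v] by (simp add: node_def deg_def)
    \<comment> \<open>With two vertices in \<open>V\<close> the set \<open>{v}\<close> is proper and
      induces at most two loops, so degree 3 leaves exactly one neighbour and two loops.\<close>
    have "card {v} \<noteq> card V" using assms by simp
    then have "{v} \<noteq> V" by metis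
    then have "i_all G {v} \<le> 2 * card {v}" using v by (intro i_all_le) auto
    then have "card (loops_at G v) \<le> 2" using i_all_insert[of v "{}"] by simp
    then have c: "card (nbrs G v) = 1" "card (loops_at G v) = 2" using d le1 by linarith+
    then obtain x where x: "nbrs G v = {x}" by (auto simp: card_1_singleton_iff)
    \<comment> \<open>A blocking set would contain \<open>x\<close>, the only neighbour of
      \<open>v\<close>, and \<open>full_nbrs\<close> would make it all of
      \<open>V - {v}\<close>.\<close>
    have "\<not> Y \<subset> V - {v}" if "full Y" "x \<in> Y" for Y
    proof
      assume "Y \<subset> V - {v}"
      then have "v \<notin> Y" "insert v Y \<noteq> V" by auto
      then show False using full_nbrs[OF that(1) nodes[OF v]] that(2) x by auto
    qed
    moreover have "x \<in> nbrs G v" "loops_at G v \<noteq> {}" using x c by auto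
    ultimately obtain G' where "looped_simple_graph G'" "rigid_Mlc_circuit G'" "verts G' = V - {v}" "one_extension G' G"
      using loop_reduction[OF nodes[OF v]] by blast
    then show thesis using that[of G'] smaller[OF nodes[OF v]] by simp
  qed
qed

text \<open>Base case of the reduction; an empty vertex set is impossible since the count on
  \<open>V\<close> would have to be 1.\<close>

lemma single_vertex:
  assumes "card V < 2"
  shows "is_K1_3 G"
proof -
  have "card V \<noteq> 0"
  proof
    assume "card V = 0"
    then have "V = {}" by simp
    then show False using i_all_V_eq by simp
  qed
  then have "card V = 1" using assms by linarith
  then obtain v where V: "V = {v}" by (auto simp: card_1_singleton_iff)
  have "e \<notin> E" for e
  proof
    assume "e \<in> E"
    then have "e \<subseteq> {v}" "card e = 2" using edge_subset edge_card V by auto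
    then show False using card_mono[of "{v}" e] by simp
  qed
  then have "E = {}" by blast
  moreover have "card L = 3" using circuit V \<open>E = {}\<close> by (simp add: rigid_Mlc_circuit_def)
  moreover have "\<forall>l\<in>L. fst l = v" using loop_vertex V by auto
  ultimately show ?thesis using V by (auto simp: is_K1_3_def)
qed

end

text \<open>Strong induction on the number of vertices, which every reduction decreases.\<close>

lemma circuit_constructible:
  "looped_simple_graph G \<Longrightarrow> rigid_Mlc_circuit G \<Longrightarrow> constructible G"
proof (induction "card (verts G)" arbitrary: G rule: less_induct)
  case less
  interpret circuit G using less.prems by unfold_locales
  show ?case
  proof (cases "2 \<le> card (verts G)")
    case True
    then obtain G' where G': "looped_simple_graph G'" "rigid_Mlc_circuit G'" "card (verts G') < card V"
      "one_extension G' G \<or> K4_extension G' G" using reduction by blast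
    then have "constructible G'" using less.hyps by blast
    with G'(4) show ?thesis using constructible.one_ext constructible.K4_ext by blast
  next
    case False
    then show ?thesis using single_vertex by (intro constructible.K1_3) simp
  qed
qed

theorem theorem6p10:
  fixes G :: "'a lgraph"
  assumes "looped_simple_graph G"
  shows "rigid_Mlc_circuit G \<longleftrightarrow> constructible G"
  using assms circuit_constructible constructible_circuit by blast

end
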